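(* $\Vdash(\gimel\kappa\text{ is countable})\to$ every subset of $\gimel\kappa_+$ which is bounded above for the strict order $(x\triangleleft y)=1$ is countable.
   Context: Realizability algebra $\mathcal A$ (terms $\Lambda$, stacks $\Pi$, instructions $B,C,I,K,W,\mathrm{cc}$, continuations $k_\pi$, execution $\succ$ given by $(\xi)\eta\star\pi\succ\xi\star\eta\cdot\pi$, $I\star\xi\cdot\pi\succ\xi\star\pi$, $K\star\xi\cdot\eta\cdot\pi\succ\xi\star\pi$, $W\star\xi\cdot\eta\cdot\pi\succ\xi\star\eta\cdot\eta\cdot\pi$, $C\star\xi\cdot\eta\cdot\zeta\cdot\pi\succ\xi\star\zeta\cdot\eta\cdot\pi$, $B\star\xi\cdot\eta\cdot\zeta\cdot\pi\succ\xi\star(\eta)\zeta\cdot\pi$, $\mathrm{cc}\star\xi\cdot\pi\succ\xi\star k_\pi\cdot\pi$, $k_\pi\star\xi\cdot\varpi\succ\xi\star\pi$; set $\perp\!\!\!\perp$ of processes closed under anti-execution; proof-like terms QP), coherent, in a ground model $\mathcal M\models$ ZF+$V=L$. Realizability model $\mathcal N_{\mathcal A}$: individuals of $\mathcal M$; $\|\top\|=\emptyset$, $\|\bot\|=\Pi$, $\|a\not\varepsilon b\|=\{\pi:(a,\pi)\in b\}$, $\|a\subset b\|=\bigcup_c\{\xi\cdot\pi:(c,\pi)\in a,\xi\Vdash c\notin b\}$, $\|a\notin b\|=\bigcup_c\{\xi\cdot\xi'\cdot\pi:(c,\pi)\in b,\xi\Vdash a\subset c,\xi'\Vdash c\subset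 a\}$, $\|A\to B\|=\{\xi\cdot\pi:\xi\Vdash A,\pi\in\|B\|\}$, $\|\forall xA\|=\bigcup_a\|A[a/x]\|$; $\xi\Vdash F$ iff $\xi\star\pi\in\perp\!\!\!\perp$ for all $\pi\in\|F\|$; $\Vdash F$ means some proof-like term realizes $F$. Functions of $\mathcal M$ extend to $\mathcal N_{\mathcal A}$; $\gimel X=X\times\Pi$. In $\mathcal M$, $\kappa=\mathrm{card}(\Lambda\cup\Pi\cup\mathbb N)$, $\kappa_+=\mathcal P(\kappa)$, and $\triangleleft$ is a strict well ordering of $\kappa_+$ whose least element is $\emptyset$ and each of whose proper initial segments has cardinality $\le\kappa$; $(x\triangleleft y)\in\{0,1\}$ is the function of $\mathcal M$ equal to $1$ iff $x\triangleleft y$, extended to a function $(\gimel\kappa_+)^2\to\gimel2$ in $\mathcal N_{\mathcal A}$. *)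

theory Defs
  imports Main
begin

section \<open>First-order models of ZF\<close>

datatype fm = Member nat nat | Equals nat nat | Neg fm | And fm fm | All nat fm

primrec sat :: "('v \<Rightarrow> 'v \<Rightarrow> bool) \<Rightarrow> (nat \<Rightarrow> 'v) \<Rightarrow> fm \<Rightarrow> bool" where
  "sat E s (Member i j) \<longleftrightarrow> E (s i) (s j)"
| "sat E s (Equals i j) \<longleftrightarrow> s i = s j"
| "sat E s (Neg p) \<longleftrightarrow> \<not> sat E s p"
| "sat E s (And p q) \<longleftrightarrow> sat E s p \<and> sat E s q"
| "sat E s (All i p) \<longleftrightarrow> (\<forall>x. sat E (s(i := x)) p)"

text \<open>A model of set theory is a type of individuals with a binary relation, which need not be
  well-founded from outside. The two axiom schemes range over first-order formulas only, with
  parameters supplied by the assignment \<open>s\<close>.\<close>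

definition ZF :: "('v \<Rightarrow> 'v \<Rightarrow> bool) \<Rightarrow> bool" where
  "ZF E \<longleftrightarrow>
    \<comment> \<open>extensionality\<close>
    (\<forall>a b. (\<forall>x. E x a \<longleftrightarrow> E x b) \<longrightarrow> a = b) \<and>
    \<comment> \<open>foundation\<close>
    (\<forall>a. (\<exists>x. E x a) \<longrightarrow> (\<exists>x. E x a \<and> (\<forall>y. E y x \<longrightarrow> \<not> E y a))) \<and>
    \<comment> \<open>pairing\<close>
    (\<forall>a b. \<exists>c. \<forall>x. E x c \<longleftrightarrow> x = a \<or> x = b) \<and>
    \<comment> \<open>union\<close>
    (\<forall>a. \<exists>b. \<forall>x. E x b \<longleftrightarrow> (\<exists>y. E y a \<and> E x y)) \<and>
    \<comment> \<open>power set\<close>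
    (\<forall>a. \<exists>b. \<forall>x. E x b \<longleftrightarrow> (\<forall>y. E y x \<longrightarrow> E y a)) \<and>
    \<comment> \<open>infinity\<close>
    (\<exists>w. (\<exists>e. (\<forall>x. \<not> E x e) \<and> E e w) \<and>
         (\<forall>x. E x w \<longrightarrow> (\<exists>y. E y w \<and> (\<forall>z. E z y \<longleftrightarrow> E z x \<or> z = x)))) \<and>
    \<comment> \<open>separation\<close>
    (\<forall>p s a. \<exists>b. \<forall>x. E x b \<longleftrightarrow> E x a \<and> sat E (s(0 := x)) p) \<and>
    \<comment> \<open>replacement\<close>
    (\<forall>p s a. (\<forall>x. E x a \<longrightarrow> (\<exists>!y. sat E (s(0 := x, 1 := y)) p)) \<longrightarrow>
       (\<exists>b. \<forall>y. E y b \<longleftrightarrow> (\<exists>x. E x a \<and> sat E (s(0 := x, 1 := y)) p)))"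

section \<open>Set theory inside a model\<close>

text \<open>All quantifiers over \<open>'v\<close> below are quantifiers over individuals of the model, so each
  notion is the interpretation in the model of a set-theoretic one.\<close>

context
  fixes E :: "'v \<Rightarrow> 'v \<Rightarrow> bool"  (infix \<open>\<in>\<^sub>M\<close> 50)
begin

text \<open>The set \<open>{x. P x}\<close> of the model; meaningful only if the model contains it.\<close>

definition set_of :: "('v \<Rightarrow> bool) \<Rightarrow> 'v" where
  "set_of P = (THE a. \<forall>x. x \<in>\<^sub>M a \<longleftrightarrow> P x)"

definition subset_in :: "'v \<Rightarrow> 'v \<Rightarrow> bool" where
  "subset_in a b \<longleftrightarrow> (\<forall>x. x \<in>\<^sub>M a \<longrightarrow> x \<in>\<^sub>M b)"

definition emp :: 'v where
  "emp = set_of (\<lambda>x. False)"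

definition upair :: "'v \<Rightarrow> 'v \<Rightarrow> 'v" where
  "upair a b = set_of (\<lambda>x. x = a \<or> x = b)"

definition opair :: "'v \<Rightarrow> 'v \<Rightarrow> 'v" where
  "opair a b = upair (upair a a) (upair a b)"

definition un :: "'v \<Rightarrow> 'v \<Rightarrow> 'v" where
  "un a b = set_of (\<lambda>x. x \<in>\<^sub>M a \<or> x \<in>\<^sub>M b)"

definition prod_in :: "'v \<Rightarrow> 'v \<Rightarrow> 'v" where
  "prod_in a b = set_of (\<lambda>z. \<exists>x y. x \<in>\<^sub>M a \<and> y \<in>\<^sub>M b \<and> z = opair x y)"

definition powerset :: "'v \<Rightarrow> 'v" where
  "powerset a = set_of (\<lambda>x. subset_in x a)"

definition succ :: "'v \<Rightarrow> 'v" where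
  "succ a = set_of (\<lambda>x. x \<in>\<^sub>M a \<or> x = a)"

definition one :: 'v where
  "one = succ emp"

definition omega :: 'v where
  "omega = set_of (\<lambda>n. \<forall>w. emp \<in>\<^sub>M w \<and> (\<forall>x. x \<in>\<^sub>M w \<longrightarrow> succ x \<in>\<^sub>M w) \<longrightarrow> n \<in>\<^sub>M w)"

definition is_fun :: "'v \<Rightarrow> 'v \<Rightarrow> 'v \<Rightarrow> bool" where
  "is_fun f a b \<longleftrightarrow> subset_in f (prod_in a b) \<and> (\<forall>x. x \<in>\<^sub>M a \<longrightarrow> (\<exists>!y. opair x y \<in>\<^sub>M f))"

definition ap :: "'v \<Rightarrow> 'v \<Rightarrow> 'v" where
  "ap f x = (THE y. opair x y \<in>\<^sub>M f)"

definition lepoll_in :: "'v \<Rightarrow> 'v \<Rightarrow> bool" where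
  "lepoll_in a b \<longleftrightarrow> (\<exists>f. is_fun f a b \<and>
     (\<forall>x y. x \<in>\<^sub>M a \<and> y \<in>\<^sub>M a \<and> ap f x = ap f y \<longrightarrow> x = y))"

definition eqpoll_in :: "'v \<Rightarrow> 'v \<Rightarrow> bool" where
  "eqpoll_in a b \<longleftrightarrow> (\<exists>f. is_fun f a b \<and>
     (\<forall>x y. x \<in>\<^sub>M a \<and> y \<in>\<^sub>M a \<and> ap f x = ap f y \<longrightarrow> x = y) \<and>
     (\<forall>y. y \<in>\<^sub>M b \<longrightarrow> (\<exists>x. x \<in>\<^sub>M a \<and> ap f x = y)))"

definition transitive_in :: "'v \<Rightarrow> bool" where
  "transitive_in a \<longleftrightarrow> (\<forall>x. x \<in>\<^sub>M a \<longrightarrow> subset_in x a)"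

definition ordinal :: "'v \<Rightarrow> bool" where
  "ordinal a \<longleftrightarrow> transitive_in a \<and> (\<forall>x. x \<in>\<^sub>M a \<longrightarrow> transitive_in x)"

definition is_card_of :: "'v \<Rightarrow> 'v \<Rightarrow> bool" where
  "is_card_of k a \<longleftrightarrow> ordinal k \<and> eqpoll_in k a \<and> (\<forall>j. j \<in>\<^sub>M k \<longrightarrow> \<not> eqpoll_in j a)"

definition strict_wellorder :: "'v \<Rightarrow> 'v \<Rightarrow> bool" where
  "strict_wellorder r a \<longleftrightarrow> subset_in r (prod_in a a) \<and>
     (\<forall>x. \<not> opair x x \<in>\<^sub>M r) \<and>
     (\<forall>x y z. opair x y \<in>\<^sub>M r \<and> opair y z \<in>\<^sub>M r \<longrightarrow> opair x z \<in>\<^sub>M r) \<and>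
     (\<forall>x y. x \<in>\<^sub>M a \<and> y \<in>\<^sub>M a \<longrightarrow> opair x y \<in>\<^sub>M r \<or> x = y \<or> opair y x \<in>\<^sub>M r) \<and>
     (\<forall>s. subset_in s a \<and> s \<noteq> emp \<longrightarrow>
        (\<exists>x. x \<in>\<^sub>M s \<and> (\<forall>y. y \<in>\<^sub>M s \<longrightarrow> y = x \<or> opair x y \<in>\<^sub>M r)))"

definition least_element :: "'v \<Rightarrow> 'v \<Rightarrow> 'v \<Rightarrow> bool" where
  "least_element r a m \<longleftrightarrow> m \<in>\<^sub>M a \<and> (\<forall>x. x \<in>\<^sub>M a \<longrightarrow> x = m \<or> opair m x \<in>\<^sub>M r)"

definition proper_initial_segment :: "'v \<Rightarrow> 'v \<Rightarrow> 'v \<Rightarrow> bool" where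
  "proper_initial_segment r a s \<longleftrightarrow> subset_in s a \<and> s \<noteq> a \<and>
     (\<forall>x y. x \<in>\<^sub>M s \<and> opair y x \<in>\<^sub>M r \<longrightarrow> y \<in>\<^sub>M s)"

text \<open>The characteristic function of a relation \<open>r\<close> of the model, with values in
  \<open>2 = {emp, one}\<close>.\<close>

definition char_fun :: "'v \<Rightarrow> 'v \<Rightarrow> 'v \<Rightarrow> 'v" where
  "char_fun r x y = (if opair x y \<in>\<^sub>M r then one else emp)"

section \<open>The axiom of constructibility\<close>

text \<open>Assignments are functions \<open>omega \<rightarrow> a\<close> of the model. A set is a satisfaction set over \<open>a\<close> if it
  is the set of assignments satisfying some first-order formula (in the sense of the model) in the
  structure \<open>(a, \<in>)\<close>; these sets form the least family containing the interpretations of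
  \<open>v\<^sub>i \<in> v\<^sub>j\<close> and \<open>v\<^sub>i = v\<^sub>j\<close> and closed under complement, intersection and projection.\<close>

definition upd :: "'v \<Rightarrow> 'v \<Rightarrow> 'v \<Rightarrow> 'v" where
  "upd s i x = set_of (\<lambda>z. z = opair i x \<or> z \<in>\<^sub>M s \<and> (\<forall>y. z \<noteq> opair i y))"

definition sat_closed :: "'v \<Rightarrow> 'v \<Rightarrow> bool" where
  "sat_closed a D \<longleftrightarrow>
     (\<forall>i j. i \<in>\<^sub>M omega \<and> j \<in>\<^sub>M omega \<longrightarrow>
        set_of (\<lambda>s. is_fun s omega a \<and> ap s i \<in>\<^sub>M ap s j) \<in>\<^sub>M D \<and>
        set_of (\<lambda>s. is_fun s omega a \<and> ap s i = ap s j) \<in>\<^sub>M D) \<and>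
     (\<forall>R. R \<in>\<^sub>M D \<longrightarrow> set_of (\<lambda>s. is_fun s omega a \<and> \<not> s \<in>\<^sub>M R) \<in>\<^sub>M D) \<and>
     (\<forall>R Q. R \<in>\<^sub>M D \<and> Q \<in>\<^sub>M D \<longrightarrow> set_of (\<lambda>s. s \<in>\<^sub>M R \<and> s \<in>\<^sub>M Q) \<in>\<^sub>M D) \<and>
     (\<forall>R i. R \<in>\<^sub>M D \<and> i \<in>\<^sub>M omega \<longrightarrow>
        set_of (\<lambda>s. is_fun s omega a \<and> (\<exists>x. x \<in>\<^sub>M a \<and> upd s i x \<in>\<^sub>M R)) \<in>\<^sub>M D)"

definition satisfaction_set :: "'v \<Rightarrow> 'v \<Rightarrow> bool" where
  "satisfaction_set a R \<longleftrightarrow> (\<forall>D. sat_closed a D \<longrightarrow> R \<in>\<^sub>M D)"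

text \<open>\<open>b\<close> is a subset of \<open>a\<close> definable over \<open>(a, \<in>)\<close> with parameters. There is no assignment if
  \<open>a\<close> is empty; the first disjunct provides the definable subset \<open>a\<close> in that case too.\<close>

definition definable_subset :: "'v \<Rightarrow> 'v \<Rightarrow> bool" where
  "definable_subset a b \<longleftrightarrow> b = a \<or>
     (\<exists>R s. satisfaction_set a R \<and> is_fun s omega a \<and>
        b = set_of (\<lambda>x. x \<in>\<^sub>M a \<and> upd s emp x \<in>\<^sub>M R))"

text \<open>\<open>f\<close> is the sequence of the \<open>L\<^sub>\<beta>\<close> for \<open>\<beta>\<close> below \<open>\<alpha>\<close>, where \<open>L\<^sub>\<beta>\<close> is the union of the
  sets \<open>Def(L\<^sub>\<gamma>)\<close> for \<open>\<gamma>\<close> below \<open>\<beta>\<close>.\<close>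

definition L_sequence :: "'v \<Rightarrow> 'v \<Rightarrow> bool" where
  "L_sequence \<alpha> f \<longleftrightarrow> ordinal \<alpha> \<and> (\<exists>b. is_fun f \<alpha> b) \<and>
     (\<forall>\<beta>. \<beta> \<in>\<^sub>M \<alpha> \<longrightarrow> (\<forall>y. y \<in>\<^sub>M ap f \<beta> \<longleftrightarrow> (\<exists>\<gamma>. \<gamma> \<in>\<^sub>M \<beta> \<and> definable_subset (ap f \<gamma>) y)))"

definition V_eq_L :: bool where
  "V_eq_L \<longleftrightarrow> (\<forall>x. \<exists>\<alpha> f \<beta>. L_sequence \<alpha> f \<and> \<beta> \<in>\<^sub>M \<alpha> \<and> x \<in>\<^sub>M ap f \<beta>)"

end

section \<open>Realizability algebras\<close>

text \<open>All fields are individuals of the ground model; the operations are functions in the sense of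
  the model.\<close>

record 'v ralg =
  Terms :: 'v
  Stacks :: 'v
  Procs :: 'v
  app_op :: 'v
  push_op :: 'v
  star_op :: 'v
  cont_op :: 'v
  cB :: 'v
  cC :: 'v
  cI :: 'v
  cK :: 'v
  cW :: 'v
  ccc :: 'v
  Pole :: 'v
  QP :: 'v

context
  fixes E :: "'v \<Rightarrow> 'v \<Rightarrow> bool"  (infix \<open>\<in>\<^sub>M\<close> 50)
    and A :: "'v ralg"
begin

definition app :: "'v \<Rightarrow> 'v \<Rightarrow> 'v" where
  "app \<xi> \<eta> = ap E (app_op A) (opair E \<xi> \<eta>)"

definition push :: "'v \<Rightarrow> 'v \<Rightarrow> 'v" where
  "push \<xi> \<pi> = ap E (push_op A) (opair E \<xi> \<pi>)"

definition star :: "'v \<Rightarrow> 'v \<Rightarrow> 'v" where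
  "star \<xi> \<pi> = ap E (star_op A) (opair E \<xi> \<pi>)"

definition cont :: "'v \<Rightarrow> 'v" where
  "cont \<pi> = ap E (cont_op A) \<pi>"

inductive exec_step :: "'v \<Rightarrow> 'v \<Rightarrow> bool" where
  "\<lbrakk>\<xi> \<in>\<^sub>M Terms A; \<eta> \<in>\<^sub>M Terms A; \<pi> \<in>\<^sub>M Stacks A\<rbrakk> \<Longrightarrow>
     exec_step (star (app \<xi> \<eta>) \<pi>) (star \<xi> (push \<eta> \<pi>))"
| "\<lbrakk>\<xi> \<in>\<^sub>M Terms A; \<pi> \<in>\<^sub>M Stacks A\<rbrakk> \<Longrightarrow>
     exec_step (star (cI A) (push \<xi> \<pi>)) (star \<xi> \<pi>)"
| "\<lbrakk>\<xi> \<in>\<^sub>M Terms A; \<eta> \<in>\<^sub>M Terms A; \<pi> \<in>\<^sub>M Stacks A\<rbrakk> \<Longrightarrow>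
     exec_step (star (cK A) (push \<xi> (push \<eta> \<pi>))) (star \<xi> \<pi>)"
| "\<lbrakk>\<xi> \<in>\<^sub>M Terms A; \<eta> \<in>\<^sub>M Terms A; \<pi> \<in>\<^sub>M Stacks A\<rbrakk> \<Longrightarrow>
     exec_step (star (cW A) (push \<xi> (push \<eta> \<pi>))) (star \<xi> (push \<eta> (push \<eta> \<pi>)))"
| "\<lbrakk>\<xi> \<in>\<^sub>M Terms A; \<eta> \<in>\<^sub>M Terms A; \<zeta> \<in>\<^sub>M Terms A; \<pi> \<in>\<^sub>M Stacks A\<rbrakk> \<Longrightarrow>
     exec_step (star (cC A) (push \<xi> (push \<eta> (push \<zeta> \<pi>)))) (star \<xi> (push \<zeta> (push \<eta> \<pi>)))"
| "\<lbrakk>\<xi> \<in>\<^sub>M Terms A; \<eta> \<in>\<^sub>M Terms A; \<zeta> \<in>\<^sub>M Terms A; \<pi> \<in>\<^sub>M Stacks A\<rbrakk> \<Longrightarrow>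
     exec_step (star (cB A) (push \<xi> (push \<eta> (push \<zeta> \<pi>)))) (star \<xi> (push (app \<eta> \<zeta>) \<pi>))"
| "\<lbrakk>\<xi> \<in>\<^sub>M Terms A; \<pi> \<in>\<^sub>M Stacks A\<rbrakk> \<Longrightarrow>
     exec_step (star (ccc A) (push \<xi> \<pi>)) (star \<xi> (push (cont \<pi>) \<pi>))"
| "\<lbrakk>\<xi> \<in>\<^sub>M Terms A; \<pi> \<in>\<^sub>M Stacks A; \<rho> \<in>\<^sub>M Stacks A\<rbrakk> \<Longrightarrow>
     exec_step (star (cont \<pi>) (push \<xi> \<rho>)) (star \<xi> \<pi>)"

text \<open>Execution is the least preorder on processes containing the steps, in the sense of the
  model.\<close>

definition exec :: "'v \<Rightarrow> 'v \<Rightarrow> bool" where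
  "exec p q \<longleftrightarrow> p \<in>\<^sub>M Procs A \<and> q \<in>\<^sub>M Procs A \<and>
     (\<forall>R. (\<forall>x. x \<in>\<^sub>M Procs A \<longrightarrow> opair E x x \<in>\<^sub>M R) \<and>
          (\<forall>x y z. opair E x y \<in>\<^sub>M R \<and> opair E y z \<in>\<^sub>M R \<longrightarrow> opair E x z \<in>\<^sub>M R) \<and>
          (\<forall>x y. exec_step x y \<longrightarrow> opair E x y \<in>\<^sub>M R) \<longrightarrow>
        opair E p q \<in>\<^sub>M R)"

definition realizability_algebra :: bool where
  "realizability_algebra \<longleftrightarrow>
     is_fun E (app_op A) (prod_in E (Terms A) (Terms A)) (Terms A) \<and>
     is_fun E (push_op A) (prod_in E (Terms A) (Stacks A)) (Stacks A) \<and>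
     is_fun E (star_op A) (prod_in E (Terms A) (Stacks A)) (Procs A) \<and>
     is_fun E (cont_op A) (Stacks A) (Terms A) \<and>
     cB A \<in>\<^sub>M Terms A \<and> cC A \<in>\<^sub>M Terms A \<and> cI A \<in>\<^sub>M Terms A \<and>
     cK A \<in>\<^sub>M Terms A \<and> cW A \<in>\<^sub>M Terms A \<and> ccc A \<in>\<^sub>M Terms A \<and>
     subset_in E (Pole A) (Procs A) \<and>
     (\<forall>p q. exec p q \<and> q \<in>\<^sub>M Pole A \<longrightarrow> p \<in>\<^sub>M Pole A) \<and>
     subset_in E (QP A) (Terms A) \<and>
     cB A \<in>\<^sub>M QP A \<and> cC A \<in>\<^sub>M QP A \<and> cI A \<in>\<^sub>M QP A \<and>
     cK A \<in>\<^sub>M QP A \<and> cW A \<in>\<^sub>M QP A \<and> ccc A \<in>\<^sub>M QP A \<and>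
     (\<forall>\<xi> \<eta>. \<xi> \<in>\<^sub>M QP A \<and> \<eta> \<in>\<^sub>M QP A \<longrightarrow> app \<xi> \<eta> \<in>\<^sub>M QP A)"

definition coherent :: bool where
  "coherent \<longleftrightarrow>
     (\<forall>\<theta>. \<theta> \<in>\<^sub>M QP A \<longrightarrow> (\<exists>\<pi>. \<pi> \<in>\<^sub>M Stacks A \<and> \<not> star \<theta> \<pi> \<in>\<^sub>M Pole A))"

definition gimel :: "'v \<Rightarrow> 'v" where
  "gimel X = prod_in E X (Stacks A)"

end

section \<open>The realizability model\<close>

text \<open>Closed formulas with parameters in the ground model. The body of a universal quantifier is
  the map taking an individual \<open>a\<close> to the instance at \<open>a\<close>. A function of the ground model, extended
  to the realizability model, is applied directly to the parameters.\<close>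

datatype 'v rfm =
    Top
  | Bottom
  | NotEps 'v 'v
  | Subset 'v 'v
  | NotMem 'v 'v
  | Imp "'v rfm" "'v rfm"  (infixr \<open>\<^bold>\<rightarrow>\<close> 25)
  | Forall "'v \<Rightarrow> 'v rfm"  (binder \<open>\<^bold>\<forall>\<close> 10)

definition Negation :: "'v rfm \<Rightarrow> 'v rfm"  (\<open>\<^bold>\<not> _\<close> [40] 40) where
  "Negation F = (F \<^bold>\<rightarrow> Bottom)"

definition Conj :: "'v rfm \<Rightarrow> 'v rfm \<Rightarrow> 'v rfm"  (infixr \<open>\<^bold>\<and>\<close> 35) where
  "Conj F G = (\<^bold>\<not> (F \<^bold>\<rightarrow> \<^bold>\<not> G))"

definition Iff :: "'v rfm \<Rightarrow> 'v rfm \<Rightarrow> 'v rfm"  (infixr \<open>\<^bold>\<leftrightarrow>\<close> 25) where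
  "Iff F G = ((F \<^bold>\<rightarrow> G) \<^bold>\<and> (G \<^bold>\<rightarrow> F))"

definition Exists :: "('v \<Rightarrow> 'v rfm) \<Rightarrow> 'v rfm"  (binder \<open>\<^bold>\<exists>\<close> 10) where
  "Exists F = (\<^bold>\<not> (\<^bold>\<forall>x. \<^bold>\<not> F x))"

definition Eps :: "'v \<Rightarrow> 'v \<Rightarrow> 'v rfm"  (infix \<open>\<^bold>\<epsilon>\<close> 50) where
  "Eps a b = (\<^bold>\<not> NotEps a b)"

text \<open>Leibniz equality.\<close>

definition Equal :: "'v \<Rightarrow> 'v \<Rightarrow> 'v rfm"  (infix \<open>\<^bold>=\<close> 50) where
  "Equal a b = (\<^bold>\<forall>z. NotEps a z \<^bold>\<rightarrow> NotEps b z)"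

context
  fixes E :: "'v \<Rightarrow> 'v \<Rightarrow> bool"  (infix \<open>\<in>\<^sub>M\<close> 50)
    and A :: "'v ralg"
begin

text \<open>The falsity values of \<open>a \<subset> b\<close> and \<open>a \<notin> b\<close> are defined by simultaneous recursion on the
  ranks of \<open>a\<close> and \<open>b\<close>. As the relation of the model need not be well-founded from outside, the
  recursion takes place in the model: \<open>S\<close> and \<open>N\<close> are the sets of all \<open>((a, b), \<pi>)\<close>, with \<open>a\<close> and
  \<open>b\<close> in the transitive set \<open>T\<close> and \<open>\<pi>\<close> in the falsity value of \<open>a \<subset> b\<close>, respectively \<open>a \<notin> b\<close>.
  If \<open>(c, \<pi>)\<close> belongs to an element of \<open>T\<close>, then \<open>c\<close> is in \<open>T\<close> by transitivity.\<close>

definition falsity_table :: "'v \<Rightarrow> 'v \<Rightarrow> 'v \<Rightarrow> bool" where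
  "falsity_table T S N \<longleftrightarrow> transitive_in E T \<and>
     (let realizes = (\<lambda>\<xi> V a b. \<xi> \<in>\<^sub>M Terms A \<and>
            (\<forall>\<pi>. opair E (opair E a b) \<pi> \<in>\<^sub>M V \<longrightarrow> star E A \<xi> \<pi> \<in>\<^sub>M Pole A))
      in \<forall>a b. a \<in>\<^sub>M T \<and> b \<in>\<^sub>M T \<longrightarrow>
        (\<forall>\<rho>. opair E (opair E a b) \<rho> \<in>\<^sub>M S \<longleftrightarrow>
           (\<exists>c \<xi> \<pi>. \<rho> = push E A \<xi> \<pi> \<and> \<pi> \<in>\<^sub>M Stacks A \<and> opair E c \<pi> \<in>\<^sub>M a \<and>
              realizes \<xi> N c b)) \<and>
        (\<forall>\<rho>. opair E (opair E a b) \<rho> \<in>\<^sub>M N \<longleftrightarrow>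
           (\<exists>c \<xi> \<xi>' \<pi>. \<rho> = push E A \<xi> (push E A \<xi>' \<pi>) \<and> \<pi> \<in>\<^sub>M Stacks A \<and>
              opair E c \<pi> \<in>\<^sub>M b \<and> realizes \<xi> S a c \<and> realizes \<xi>' S c a)))"

primrec falsity :: "'v rfm \<Rightarrow> 'v set" where
  "falsity Top = {}"
| "falsity Bottom = {\<pi>. \<pi> \<in>\<^sub>M Stacks A}"
| "falsity (NotEps a b) = {\<pi>. \<pi> \<in>\<^sub>M Stacks A \<and> opair E a \<pi> \<in>\<^sub>M b}"
| "falsity (Subset a b) =
     {\<pi>. \<exists>T S N. falsity_table T S N \<and> a \<in>\<^sub>M T \<and> b \<in>\<^sub>M T \<and> opair E (opair E a b) \<pi> \<in>\<^sub>M S}"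
| "falsity (NotMem a b) =
     {\<pi>. \<exists>T S N. falsity_table T S N \<and> a \<in>\<^sub>M T \<and> b \<in>\<^sub>M T \<and> opair E (opair E a b) \<pi> \<in>\<^sub>M N}"
| "falsity (F \<^bold>\<rightarrow> G) =
     {push E A \<xi> \<pi> | \<xi> \<pi>. \<xi> \<in>\<^sub>M Terms A \<and>
        (\<forall>\<rho> \<in> falsity F. star E A \<xi> \<rho> \<in>\<^sub>M Pole A) \<and> \<pi> \<in> falsity G}"
| "falsity (Forall F) = (\<Union>a. falsity (F a))"

definition forces :: "'v \<Rightarrow> 'v rfm \<Rightarrow> bool" where
  "forces \<xi> F \<longleftrightarrow> \<xi> \<in>\<^sub>M Terms A \<and> (\<forall>\<pi> \<in> falsity F. star E A \<xi> \<pi> \<in>\<^sub>M Pole A)"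

definition realized :: "'v rfm \<Rightarrow> bool" where
  "realized F \<longleftrightarrow> (\<exists>\<theta>. \<theta> \<in>\<^sub>M QP A \<and> forces \<theta> F)"

end

section \<open>Formulas of the realizability model\<close>

definition SubEps :: "'v \<Rightarrow> 'v \<Rightarrow> 'v rfm" where
  "SubEps X Y = (\<^bold>\<forall>x. x \<^bold>\<epsilon> X \<^bold>\<rightarrow> x \<^bold>\<epsilon> Y)"

context
  fixes E :: "'v \<Rightarrow> 'v \<Rightarrow> bool"
begin

text \<open>\<open>n\<close> belongs to every individual that contains 0 and is closed under successor, written
  contrapositively. The individual \<open>gimel E A (omega E)\<close> has other elements in general.\<close>

definition Integer :: "'v \<Rightarrow> 'v rfm" where
  "Integer n = (\<^bold>\<forall>x. (\<^bold>\<forall>y. NotEps (succ E y) x \<^bold>\<rightarrow> NotEps y x) \<^bold>\<rightarrow>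
                  NotEps n x \<^bold>\<rightarrow> NotEps (emp E) x)"

definition Functional :: "'v \<Rightarrow> 'v rfm" where
  "Functional f = (\<^bold>\<forall>x. \<^bold>\<forall>y. \<^bold>\<forall>y'. opair E x y \<^bold>\<epsilon> f \<^bold>\<rightarrow> opair E x y' \<^bold>\<epsilon> f \<^bold>\<rightarrow> y \<^bold>= y')"

text \<open>\<open>X\<close> is the set of values taken at integers by some partial function, so finite sets are
  countable.\<close>

definition Countable :: "'v \<Rightarrow> 'v rfm" where
  "Countable X = (\<^bold>\<exists>f. Functional f \<^bold>\<and>
     (\<^bold>\<forall>x. x \<^bold>\<epsilon> X \<^bold>\<leftrightarrow> (\<^bold>\<exists>n. Integer n \<^bold>\<and> opair E n x \<^bold>\<epsilon> f)))"

definition BoundedAbove :: "('v \<Rightarrow> 'v \<Rightarrow> 'v rfm) \<Rightarrow> 'v \<Rightarrow> 'v \<Rightarrow> 'v rfm" where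
  "BoundedAbove R Y X = (\<^bold>\<exists>u. u \<^bold>\<epsilon> Y \<^bold>\<and> (\<^bold>\<forall>x. x \<^bold>\<epsilon> X \<^bold>\<rightarrow> R x u))"

end

end

(*
  Let u be an upper bound of X for the order (x < y) = 1 given by tri.  In the ground model, the
  segment S of the predecessors of u injects into kappa by some g.  If h enumerates gimel kappa in
  the realizability model, then the relation "x eps X and (n, g x) eps h" enumerates X: every
  x eps X has (x < u) = 1, so that either x is in S, g x eps gimel kappa and h gives an n, or the
  hypothesis (x < u) = 1 is 0 = 1; and the relation is functional because h is and the falsity
  value of an equation a = b depends only on whether a and b are equal in the ground model.
  The set S and the injection g are picked separately for each individual u: the realizer must be
  uniform in u, h and X, but the sets of the ground model that serve as witnesses need not be.
*)

theory Submission
  imports Defs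
begin

section \<open>Sets of the model\<close>

text \<open>The separation scheme of \<open>ZF\<close> takes formulas of type \<open>fm\<close>. A
  predicate on assignments stands in for such a formula, so that properties are assembled by the
  closure rules below instead of being coded by hand.\<close>

definition definable :: "('v \<Rightarrow> 'v \<Rightarrow> bool) \<Rightarrow> ((nat \<Rightarrow> 'v) \<Rightarrow> bool) \<Rightarrow> bool" where
  "definable E P \<longleftrightarrow> (\<exists>p. \<forall>s. sat E s p \<longleftrightarrow> P s)"

lemma definable_mem: "definable E (\<lambda>s. E (s i) (s j))"
  unfolding definable_def by (rule exI[of _ "Member i j"]) simp

lemma definable_eq: "definable E (\<lambda>s. s i = s j)"
  unfolding definable_def by (rule exI[of _ "Equals i j"]) simp

lemma definable_not: "definable E P \<Longrightarrow> definable E (\<lambda>s. \<not> P s)"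
  unfolding definable_def by (metis sat.simps(3))

lemma definable_conj: "definable E P \<Longrightarrow> definable E Q \<Longrightarrow> definable E (\<lambda>s. P s \<and> Q s)"
  unfolding definable_def by (metis sat.simps(4))

lemma definable_all: "definable E P \<Longrightarrow> definable E (\<lambda>s. \<forall>x. P (s(i := x)))"
  unfolding definable_def by (metis sat.simps(5))

lemma definable_disj: "definable E P \<Longrightarrow> definable E Q \<Longrightarrow> definable E (\<lambda>s. P s \<or> Q s)"
  using definable_not[OF definable_conj[OF definable_not definable_not]] by simp

lemma definable_iff: "definable E P \<Longrightarrow> definable E Q \<Longrightarrow> definable E (\<lambda>s. P s \<longleftrightarrow> Q s)"
  unfolding iff_conv_conj_imp imp_conv_disj
  by (intro definable_conj definable_disj definable_not)

lemma definable_ex: "definable E P \<Longrightarrow> definable E (\<lambda>s. \<exists>x. P (s(i := x)))"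
  using definable_not[OF definable_all[OF definable_not]] by simp

section \<open>Elementary set constructions in a model of ZF\<close>

locale zf_model =
  fixes E :: "'v \<Rightarrow> 'v \<Rightarrow> bool"  (infix \<open>\<in>\<^sub>M\<close> 50)
  assumes zf: "ZF E"
begin

lemma extensionality: "(\<And>x. x \<in>\<^sub>M a \<longleftrightarrow> x \<in>\<^sub>M b) \<Longrightarrow> a = b"
proof -
  have "\<forall>a b. (\<forall>x. x \<in>\<^sub>M a \<longleftrightarrow> x \<in>\<^sub>M b) \<longrightarrow> a = b"
    using zf unfolding ZF_def by (elim conjE)
  then show "(\<And>x. x \<in>\<^sub>M a \<longleftrightarrow> x \<in>\<^sub>M b) \<Longrightarrow> a = b"
    by simp
qed

lemma pairing: "\<exists>c. \<forall>x. x \<in>\<^sub>M c \<longleftrightarrow> x = a \<or> x = b"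
proof -
  have "\<forall>a b. \<exists>c. \<forall>x. x \<in>\<^sub>M c \<longleftrightarrow> x = a \<or> x = b"
    using zf unfolding ZF_def by (elim conjE)
  then show ?thesis
    by simp
qed

lemma union_exists: "\<exists>b. \<forall>x. x \<in>\<^sub>M b \<longleftrightarrow> (\<exists>y. y \<in>\<^sub>M a \<and> x \<in>\<^sub>M y)"
proof -
  have "\<forall>a. \<exists>b. \<forall>x. x \<in>\<^sub>M b \<longleftrightarrow> (\<exists>y. y \<in>\<^sub>M a \<and> x \<in>\<^sub>M y)"
    using zf unfolding ZF_def by (elim conjE)
  then show ?thesis
    by simp
qed

lemma powerset_exists: "\<exists>b. \<forall>x. x \<in>\<^sub>M b \<longleftrightarrow> (\<forall>y. y \<in>\<^sub>M x \<longrightarrow> y \<in>\<^sub>M a)"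
proof -
  have "\<forall>a. \<exists>b. \<forall>x. x \<in>\<^sub>M b \<longleftrightarrow> (\<forall>y. y \<in>\<^sub>M x \<longrightarrow> y \<in>\<^sub>M a)"
    using zf unfolding ZF_def by (elim conjE)
  then show ?thesis
    by simp
qed

text \<open>Variable 0 ranges over the elements of \<open>a\<close>; the other variables of
  \<open>s\<close> hold the parameters.\<close>

lemma separation:
  assumes "definable E P"
  shows "\<exists>b. \<forall>x. x \<in>\<^sub>M b \<longleftrightarrow> x \<in>\<^sub>M a \<and> P (s(0 := x))"
proof -
  obtain p where p: "\<forall>s. sat E s p \<longleftrightarrow> P s"
    using assms unfolding definable_def by blast
  have "\<forall>p s a. \<exists>b. \<forall>x. x \<in>\<^sub>M b \<longleftrightarrow> x \<in>\<^sub>M a \<and> sat E (s(0 := x)) p"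
    using zf unfolding ZF_def by (elim conjE)
  then have "\<exists>b. \<forall>x. x \<in>\<^sub>M b \<longleftrightarrow> x \<in>\<^sub>M a \<and> sat E (s(0 := x)) p"
    by simp
  then show ?thesis
    by (simp only: p)
qed

lemma empty_exists: "\<exists>e. \<forall>x. x \<in>\<^sub>M e \<longleftrightarrow> False"
  using separation[OF definable_not[OF definable_eq[of E 0 0]]] by simp

text \<open>Extensionality turns existence into the unique existence required by the description in
  \<open>set_of\<close>.\<close>

lemma mem_set_of:
  assumes "\<exists>b. \<forall>x. x \<in>\<^sub>M b \<longleftrightarrow> P x"
  shows "x \<in>\<^sub>M set_of E P \<longleftrightarrow> P x"
proof -
  have "\<exists>!b. \<forall>x. x \<in>\<^sub>M b \<longleftrightarrow> P x"
    using assms extensionality by blast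
  from theI'[OF this] show ?thesis
    unfolding set_of_def by blast
qed

lemma mem_upair [simp]: "x \<in>\<^sub>M upair E a b \<longleftrightarrow> x = a \<or> x = b"
  unfolding upair_def by (rule mem_set_of[OF pairing])

lemma upair_eq_iff: "z = upair E a b \<longleftrightarrow> (\<forall>x. x \<in>\<^sub>M z \<longleftrightarrow> x = a \<or> x = b)"
  using extensionality mem_upair by metis

lemma mem_opair [simp]: "x \<in>\<^sub>M opair E a b \<longleftrightarrow> x = upair E a a \<or> x = upair E a b"
  unfolding opair_def by simp

lemma opair_eq_iff:
  "z = opair E a b \<longleftrightarrow> (\<forall>x. x \<in>\<^sub>M z \<longleftrightarrow> x = upair E a a \<or> x = upair E a b)"
  unfolding opair_def by (rule upair_eq_iff)

lemma upair_inject: "upair E a b = upair E c d \<longleftrightarrow> a = c \<and> b = d \<or> a = d \<and> b = c"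
  unfolding upair_eq_iff[of "upair E a b"] mem_upair by metis

lemma opair_inject [simp]: "opair E a b = opair E c d \<longleftrightarrow> a = c \<and> b = d"
  unfolding opair_def upair_inject by auto

lemma mem_un [simp]: "x \<in>\<^sub>M un E a b \<longleftrightarrow> x \<in>\<^sub>M a \<or> x \<in>\<^sub>M b"
proof -
  have "\<exists>c. \<forall>x. x \<in>\<^sub>M c \<longleftrightarrow> x \<in>\<^sub>M a \<or> x \<in>\<^sub>M b"
    using union_exists[of "upair E a b"] by auto
  from mem_set_of[OF this] show ?thesis
    unfolding un_def .
qed

lemma mem_powerset [simp]: "x \<in>\<^sub>M powerset E a \<longleftrightarrow> subset_in E x a"
  unfolding powerset_def subset_in_def by (rule mem_set_of[OF powerset_exists])

lemma not_mem_emp [simp]: "\<not> x \<in>\<^sub>M emp E"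
  using mem_set_of[OF empty_exists] unfolding emp_def by blast

lemma mem_succ [simp]: "x \<in>\<^sub>M succ E a \<longleftrightarrow> x \<in>\<^sub>M a \<or> x = a"
proof -
  have "\<exists>c. \<forall>x. x \<in>\<^sub>M c \<longleftrightarrow> x \<in>\<^sub>M a \<or> x = a"
    by (rule exI[of _ "un E a (upair E a a)"]) simp
  from mem_set_of[OF this] show ?thesis
    unfolding succ_def .
qed

lemma emp_neq_one: "emp E \<noteq> one E"
  unfolding one_def by (metis mem_succ not_mem_emp)

section \<open>Definability of pairs; products, functions and fields\<close>

lemma definable_eq_upair: "definable E (\<lambda>s. s i = upair E (s j) (s k))"
proof -
  \<comment> \<open>\<open>n\<close> differs from \<open>i\<close>, \<open>j\<close> and
    \<open>k\<close>, so binding it leaves their values alone.\<close>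
  define n where "n = Suc (i + j + k)"
  have "definable E (\<lambda>s. \<forall>x. (s(n := x)) n \<in>\<^sub>M (s(n := x)) i \<longleftrightarrow>
      (s(n := x)) n = (s(n := x)) j \<or> (s(n := x)) n = (s(n := x)) k)"
    by (rule definable_all) (intro definable_iff definable_disj definable_mem definable_eq)
  then show ?thesis
    by (simp add: upair_eq_iff n_def)
qed

lemma definable_eq_opair: "definable E (\<lambda>s. s i = opair E (s j) (s k))"
proof -
  define n where "n = Suc (i + j + k)"
  have "definable E (\<lambda>s. \<forall>x. (s(n := x)) n \<in>\<^sub>M (s(n := x)) i \<longleftrightarrow>
      (s(n := x)) n = upair E ((s(n := x)) j) ((s(n := x)) j) \<or>
      (s(n := x)) n = upair E ((s(n := x)) j) ((s(n := x)) k))"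
    by (rule definable_all) (intro definable_iff definable_disj definable_mem definable_eq_upair)
  then show ?thesis
    by (simp add: opair_eq_iff n_def)
qed

lemma definable_opair_mem: "definable E (\<lambda>s. opair E (s i) (s j) \<in>\<^sub>M s k)"
proof -
  define n where "n = Suc (i + j + k)"
  have "definable E (\<lambda>s. \<exists>x. (s(n := x)) n = opair E ((s(n := x)) i) ((s(n := x)) j) \<and>
      (s(n := x)) n \<in>\<^sub>M (s(n := x)) k)"
    by (rule definable_ex) (intro definable_conj definable_mem definable_eq_opair)
  then show ?thesis
    by (simp add: n_def)
qed

text \<open>A Kuratowski pair of an element of \<open>a\<close> and an element of \<open>b\<close>
  lies in the double power set of \<open>un E a b\<close>, from which separation cuts out the
  product.\<close>

lemma mem_prod_in: "z \<in>\<^sub>M prod_in E a b \<longleftrightarrow> (\<exists>x y. x \<in>\<^sub>M a \<and> y \<in>\<^sub>M b \<and> z = opair E x y)"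
proof -
  have "definable E (\<lambda>s. s 3 \<in>\<^sub>M s 1 \<and> s 4 \<in>\<^sub>M s 2 \<and> s 0 = opair E (s 3) (s 4))"
    by (intro definable_conj definable_mem definable_eq_opair)
  from definable_ex[OF definable_ex[OF this, of 4], of 3]
  have "definable E (\<lambda>s. \<exists>x y. x \<in>\<^sub>M s 1 \<and> y \<in>\<^sub>M s 2 \<and> s 0 = opair E x y)"
    by simp
  from separation[OF this, of "powerset E (powerset E (un E a b))" "(\<lambda>_. a)(2 := b)"]
  obtain c where c: "\<And>z. z \<in>\<^sub>M c \<longleftrightarrow> subset_in E z (powerset E (un E a b)) \<and>
      (\<exists>x y. x \<in>\<^sub>M a \<and> y \<in>\<^sub>M b \<and> z = opair E x y)"
    by auto
  have "z \<in>\<^sub>M c \<longleftrightarrow> (\<exists>x y. x \<in>\<^sub>M a \<and> y \<in>\<^sub>M b \<and> z = opair E x y)" for z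
    unfolding c by (auto simp: subset_in_def)
  then have "\<exists>c. \<forall>z. z \<in>\<^sub>M c \<longleftrightarrow> (\<exists>x y. x \<in>\<^sub>M a \<and> y \<in>\<^sub>M b \<and> z = opair E x y)"
    by blast
  from mem_set_of[OF this] show ?thesis
    unfolding prod_in_def .
qed

lemma opair_mem_prod_in [simp]: "opair E x y \<in>\<^sub>M prod_in E a b \<longleftrightarrow> x \<in>\<^sub>M a \<and> y \<in>\<^sub>M b"
  by (auto simp: mem_prod_in)

lemma opair_mem_iff_ap:
  assumes "is_fun E f a b" "x \<in>\<^sub>M a"
  shows "opair E x y \<in>\<^sub>M f \<longleftrightarrow> y = ap E f x"
proof -
  have ex1: "\<exists>!y. opair E x y \<in>\<^sub>M f"
    using assms unfolding is_fun_def by blast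
  from theI'[OF this] have "opair E x (ap E f x) \<in>\<^sub>M f"
    unfolding ap_def .
  with ex1 show ?thesis
    by blast
qed

lemma is_fun_opairD: "is_fun E f a b \<Longrightarrow> opair E x y \<in>\<^sub>M f \<Longrightarrow> x \<in>\<^sub>M a \<and> y \<in>\<^sub>M b"
  unfolding is_fun_def subset_in_def by force

lemma ap_mem: "is_fun E f a b \<Longrightarrow> x \<in>\<^sub>M a \<Longrightarrow> ap E f x \<in>\<^sub>M b"
  using is_fun_opairD opair_mem_iff_ap by blast

text \<open>The components of a Kuratowski pair are elements of its elements, so the union of the
  union of \<open>r\<close> will do. Such a bound is what separation needs in
  \<open>transport_exists\<close>.\<close>

lemma field_exists: "\<exists>F. \<forall>x y. opair E x y \<in>\<^sub>M r \<longrightarrow> x \<in>\<^sub>M F \<and> y \<in>\<^sub>M F"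
proof -
  obtain U where U: "\<And>x. x \<in>\<^sub>M U \<longleftrightarrow> (\<exists>y. y \<in>\<^sub>M r \<and> x \<in>\<^sub>M y)"
    using union_exists by blast
  obtain F where "\<And>x. x \<in>\<^sub>M F \<longleftrightarrow> (\<exists>y. y \<in>\<^sub>M U \<and> x \<in>\<^sub>M y)"
    using union_exists by blast
  then have "x \<in>\<^sub>M F \<and> y \<in>\<^sub>M F" if "opair E x y \<in>\<^sub>M r" for x y
    using that U by (metis mem_opair mem_upair)
  then show ?thesis
    by blast
qed

end

section \<open>Realizability algebras\<close>

text \<open>Variables are nameless: \<open>Var 0\<close> belongs to the innermost abstraction.
  Abstraction is not a constructor but is compiled to combinators by \<open>lm\<close>.\<close>

datatype 'v poly = Var nat | Cst 'v | Ap "'v poly" "'v poly"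

locale ralgebra = zf_model E for E :: "'v \<Rightarrow> 'v \<Rightarrow> bool"  (infix \<open>\<in>\<^sub>M\<close> 50) +
  fixes A :: "'v ralg"
  assumes ralgebra: "realizability_algebra E A"
begin

section \<open>Operations of the algebra and anti-execution\<close>

lemma app_op_fun: "is_fun E (app_op A) (prod_in E (Terms A) (Terms A)) (Terms A)"
  and push_op_fun: "is_fun E (push_op A) (prod_in E (Terms A) (Stacks A)) (Stacks A)"
  and star_op_fun: "is_fun E (star_op A) (prod_in E (Terms A) (Stacks A)) (Procs A)"
  and cont_op_fun: "is_fun E (cont_op A) (Stacks A) (Terms A)"
  using ralgebra unfolding realizability_algebra_def by blast+

lemma combinators_QP [simp]:
  "cB A \<in>\<^sub>M QP A" "cC A \<in>\<^sub>M QP A" "cI A \<in>\<^sub>M QP A" "cK A \<in>\<^sub>M QP A" "cW A \<in>\<^sub>M QP A"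
  "ccc A \<in>\<^sub>M QP A"
  using ralgebra unfolding realizability_algebra_def by blast+

lemma app_QP [simp]: "\<xi> \<in>\<^sub>M QP A \<Longrightarrow> \<eta> \<in>\<^sub>M QP A \<Longrightarrow> app E A \<xi> \<eta> \<in>\<^sub>M QP A"
  using ralgebra unfolding realizability_algebra_def by blast

lemma QP_Terms: "\<xi> \<in>\<^sub>M QP A \<Longrightarrow> \<xi> \<in>\<^sub>M Terms A"
  using ralgebra unfolding realizability_algebra_def subset_in_def by blast

lemmas combinators_Terms [simp] = combinators_QP[THEN QP_Terms]

lemma app_Terms [simp]: "\<xi> \<in>\<^sub>M Terms A \<Longrightarrow> \<eta> \<in>\<^sub>M Terms A \<Longrightarrow> app E A \<xi> \<eta> \<in>\<^sub>M Terms A"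
  unfolding app_def by (rule ap_mem[OF app_op_fun]) simp

lemma push_Stacks [simp]: "\<xi> \<in>\<^sub>M Terms A \<Longrightarrow> \<pi> \<in>\<^sub>M Stacks A \<Longrightarrow> push E A \<xi> \<pi> \<in>\<^sub>M Stacks A"
  unfolding push_def by (rule ap_mem[OF push_op_fun]) simp

lemma star_Procs [simp]: "\<xi> \<in>\<^sub>M Terms A \<Longrightarrow> \<pi> \<in>\<^sub>M Stacks A \<Longrightarrow> star E A \<xi> \<pi> \<in>\<^sub>M Procs A"
  unfolding star_def by (rule ap_mem[OF star_op_fun]) simp

lemma cont_Terms [simp]: "\<pi> \<in>\<^sub>M Stacks A \<Longrightarrow> cont E A \<pi> \<in>\<^sub>M Terms A"
  unfolding cont_def by (rule ap_mem[OF cont_op_fun])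

text \<open>A single step lies in every relation over which \<open>exec\<close> quantifies and joins
  two processes, so it is an execution.\<close>

lemma Pole_exec_step:
  assumes "exec_step E A p q" "q \<in>\<^sub>M Pole A"
  shows "p \<in>\<^sub>M Pole A"
proof -
  have "p \<in>\<^sub>M Procs A" "q \<in>\<^sub>M Procs A"
    using assms(1) by (induction rule: exec_step.induct) simp_all
  with assms(1) have "exec E A p q"
    unfolding exec_def by blast
  with assms(2) show ?thesis
    using ralgebra unfolding realizability_algebra_def by blast
qed

lemmas Pole_app = Pole_exec_step[OF exec_step.intros(1)]
lemmas Pole_I = Pole_exec_step[OF exec_step.intros(2)]
lemmas Pole_K = Pole_exec_step[OF exec_step.intros(3)]
lemmas Pole_W = Pole_exec_step[OF exec_step.intros(4)]
lemmas Pole_C = Pole_exec_step[OF exec_step.intros(5)]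
lemmas Pole_B = Pole_exec_step[OF exec_step.intros(6)]
lemmas Pole_cc = Pole_exec_step[OF exec_step.intros(7)]
lemmas Pole_cont = Pole_exec_step[OF exec_step.intros(8)]

subsection \<open>Combinatory abstraction\<close>

primrec ev :: "(nat \<Rightarrow> 'v) \<Rightarrow> 'v poly \<Rightarrow> 'v" where
  "ev s (Var i) = s i"
| "ev s (Cst c) = c"
| "ev s (Ap t u) = app E A (ev s t) (ev s u)"

abbreviation bind :: "'v \<Rightarrow> (nat \<Rightarrow> 'v) \<Rightarrow> nat \<Rightarrow> 'v"  (infixr \<open>\<lhd>\<close> 65) where
  "a \<lhd> s \<equiv> case_nat a s"

text \<open>The invariant of \<open>pass t\<close> is \<open>pass t \<star> \<xi> \<cdot> a \<cdot> \<pi> \<succ> \<xi> \<star> t[a] \<cdot> \<pi>\<close>. Passing \<open>t[a]\<close> as an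
  argument makes the abstraction \<open>lm t\<close> exact: \<open>lm t \<star> a \<cdot> \<pi> \<succ> t[a] \<star> \<pi>\<close>, whereas the usual
  translation through \<open>S = \<lambda>f g x. f x (g x)\<close> would leave unevaluated applications in
  argument position.\<close>

primrec pass :: "'v poly \<Rightarrow> 'v poly" where
  "pass (Var i) = (case i of 0 \<Rightarrow> Cst (cI A)
     | Suc j \<Rightarrow> Ap (Ap (Cst (cC A)) (Ap (Cst (cB A)) (Cst (cK A)))) (Var j))"
| "pass (Cst c) = Ap (Ap (Cst (cC A)) (Ap (Cst (cB A)) (Cst (cK A)))) (Cst c)"
| "pass (Ap t u) =
     Ap (Ap (Cst (cB A)) (Cst (cW A)))
       (Ap (Ap (Cst (cB A)) (pass u))
         (Ap (Ap (Cst (cB A)) (Cst (cC A)))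
           (Ap (Ap (Cst (cB A)) (pass t)) (Cst (cB A)))))"

definition lm :: "'v poly \<Rightarrow> 'v poly" where
  "lm t = Ap (pass t) (Cst (cI A))"

text \<open>Used with \<open>D = QP A\<close>: proof-like constants keep closed polynomials
  proof-like.\<close>

primrec over :: "'v \<Rightarrow> 'v poly \<Rightarrow> bool" where
  "over D (Var i) \<longleftrightarrow> True"
| "over D (Cst c) \<longleftrightarrow> c \<in>\<^sub>M D"
| "over D (Ap t u) \<longleftrightarrow> over D t \<and> over D u"

definition env :: "(nat \<Rightarrow> 'v) \<Rightarrow> bool" where
  "env s \<longleftrightarrow> (\<forall>i. s i \<in>\<^sub>M Terms A)"

lemma env_bind [simp]: "env (a \<lhd> s) \<longleftrightarrow> a \<in>\<^sub>M Terms A \<and> env s"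
  unfolding env_def by (metis nat.case(1) nat.case(2) not0_implies_Suc)

lemma env_Terms: "env s \<Longrightarrow> s i \<in>\<^sub>M Terms A"
  by (simp add: env_def)

lemma over_pass: "over (QP A) t \<Longrightarrow> over (QP A) (pass t)"
  by (induction t) (auto split: nat.splits)

lemma over_lm [simp]: "over (QP A) t \<Longrightarrow> over (QP A) (lm t)"
  by (simp add: lm_def over_pass)

lemma ev_Terms: "over (QP A) t \<Longrightarrow> env s \<Longrightarrow> ev s t \<in>\<^sub>M Terms A"
  by (induction t) (auto simp: env_Terms QP_Terms)

lemma ev_QP: "over (QP A) t \<Longrightarrow> (\<And>i. s i \<in>\<^sub>M QP A) \<Longrightarrow> ev s t \<in>\<^sub>M QP A"
  by (induction t) auto

text \<open>The run leads to \<open>K\<close> with arguments \<open>(\<xi>)c\<close> and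
  \<open>a\<close>: the argument \<open>a\<close> is dropped, and \<open>c\<close> is pushed in
  front of \<pi> as it stands.\<close>

lemma Pole_pass_constant:
  assumes "\<xi> \<in>\<^sub>M Terms A" "a \<in>\<^sub>M Terms A" "c \<in>\<^sub>M Terms A" "\<pi> \<in>\<^sub>M Stacks A"
    and "star E A \<xi> (push E A c \<pi>) \<in>\<^sub>M Pole A"
  shows "star E A (app E A (app E A (cC A) (app E A (cB A) (cK A))) c)
    (push E A \<xi> (push E A a \<pi>)) \<in>\<^sub>M Pole A"
  by (rule Pole_app Pole_C Pole_B Pole_K | simp add: assms)+

text \<open>For an application, \<open>W\<close> duplicates \<open>a\<close>, \<open>pass u\<close>
  turns the first copy into \<open>u[a]\<close>, \<open>C\<close> exchanges this with the second
  copy, \<open>pass t\<close> turns the latter into \<open>t[a]\<close>, and a final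
  \<open>B\<close> forms \<open>(t[a])u[a]\<close>.\<close>

lemma Pole_pass:
  assumes "over (QP A) t" "env s" "\<xi> \<in>\<^sub>M Terms A" "a \<in>\<^sub>M Terms A" "\<pi> \<in>\<^sub>M Stacks A"
    and "star E A \<xi> (push E A (ev (a \<lhd> s) t) \<pi>) \<in>\<^sub>M Pole A"
  shows "star E A (ev s (pass t)) (push E A \<xi> (push E A a \<pi>)) \<in>\<^sub>M Pole A"
  using assms
proof (induction t arbitrary: \<xi> \<pi>)
  case (Var i)
  show ?case
  proof (cases i)
    case 0
    with Var show ?thesis
      by (auto intro: Pole_I)
  next
    case (Suc j)
    with Var show ?thesis
      by (auto intro: Pole_pass_constant env_Terms)
  qed
next
  case (Cst c)
  then show ?case
    by (auto intro: Pole_pass_constant QP_Terms)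
next
  case (Ap t u)
  have [simp]: "ev s (pass t) \<in>\<^sub>M Terms A" "ev s (pass u) \<in>\<^sub>M Terms A"
    "ev (a \<lhd> s) t \<in>\<^sub>M Terms A" "ev (a \<lhd> s) u \<in>\<^sub>M Terms A"
    using Ap.prems by (auto intro!: ev_Terms over_pass)
  have [simp]: "\<xi> \<in>\<^sub>M Terms A" "a \<in>\<^sub>M Terms A" "\<pi> \<in>\<^sub>M Stacks A"
    "over (QP A) t" "over (QP A) u" "env s"
    using Ap.prems by auto
  \<comment> \<open>The run is traced from its end, because membership in the pole passes from a
    process to its predecessors.\<close>
  have "star E A (cB A) (push E A \<xi> (push E A (ev (a \<lhd> s) t) (push E A (ev (a \<lhd> s) u) \<pi>)))
      \<in>\<^sub>M Pole A"
    using Ap.prems by (intro Pole_B) simp_all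
  then have "star E A (ev s (pass t)) (push E A (app E A (cB A) \<xi>)
      (push E A a (push E A (ev (a \<lhd> s) u) \<pi>))) \<in>\<^sub>M Pole A"
    by (intro Ap.IH(1) Pole_app) simp_all
  then have "star E A (cC A) (push E A
      (app E A (app E A (app E A (cB A) (ev s (pass t))) (cB A)) \<xi>)
      (push E A (ev (a \<lhd> s) u) (push E A a \<pi>))) \<in>\<^sub>M Pole A"
    by (intro Pole_C Pole_app Pole_B) simp_all
  then have "star E A (ev s (pass u)) (push E A
      (app E A (app E A (app E A (cB A) (cC A))
        (app E A (app E A (cB A) (ev s (pass t))) (cB A))) \<xi>)
      (push E A a (push E A a \<pi>))) \<in>\<^sub>M Pole A"
    by (intro Ap.IH(2) Pole_app Pole_B) simp_all
  then show ?case
    unfolding pass.simps ev.simps by (intro Pole_W Pole_app Pole_B) simp_all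
qed

text \<open>Taking \<open>I\<close> for \<xi> in the invariant of \<open>pass t\<close> leaves
  \<open>t[a]\<close> in head position.\<close>

lemma Pole_lm:
  assumes "over (QP A) t" "env s" "a \<in>\<^sub>M Terms A" "\<pi> \<in>\<^sub>M Stacks A"
    and "star E A (ev (a \<lhd> s) t) \<pi> \<in>\<^sub>M Pole A"
  shows "star E A (ev s (lm t)) (push E A a \<pi>) \<in>\<^sub>M Pole A"
  unfolding lm_def ev.simps using assms
  by (intro Pole_app Pole_pass Pole_I) (simp_all add: ev_Terms over_pass)

lemma falsity_Stacks: "\<pi> \<in> falsity E A F \<Longrightarrow> \<pi> \<in>\<^sub>M Stacks A"
proof (induction F arbitrary: \<pi>)
  case (Subset a b)
  then show ?case
    unfolding falsity.simps falsity_table_def Let_def by auto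
next
  case (NotMem a b)
  then show ?case
    unfolding falsity.simps falsity_table_def Let_def by auto
qed auto

section \<open>Realized rules of deduction\<close>

lemma forces_Terms: "forces E A \<xi> F \<Longrightarrow> \<xi> \<in>\<^sub>M Terms A"
  unfolding forces_def by blast

lemma forces_Pole: "forces E A \<xi> F \<Longrightarrow> \<pi> \<in> falsity E A F \<Longrightarrow> star E A \<xi> \<pi> \<in>\<^sub>M Pole A"
  unfolding forces_def by blast

lemma falsity_Imp:
  "falsity E A (F \<^bold>\<rightarrow> G) = {push E A \<xi> \<pi> | \<xi> \<pi>. forces E A \<xi> F \<and> \<pi> \<in> falsity E A G}"
  unfolding forces_def by auto

declare falsity.simps(6) [simp del]

lemma push_falsity:
  "forces E A \<xi> F \<Longrightarrow> \<pi> \<in> falsity E A G \<Longrightarrow> push E A \<xi> \<pi> \<in> falsity E A (F \<^bold>\<rightarrow> G)"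
  unfolding falsity_Imp by blast

lemma forces_ImpI:
  assumes "\<xi> \<in>\<^sub>M Terms A"
    and "\<And>a \<pi>. forces E A a F \<Longrightarrow> \<pi> \<in> falsity E A G \<Longrightarrow> star E A \<xi> (push E A a \<pi>) \<in>\<^sub>M Pole A"
  shows "forces E A \<xi> (F \<^bold>\<rightarrow> G)"
  using assms unfolding forces_def[of E A \<xi>] falsity_Imp by blast

text \<open>Introduction of implication. Since \<open>lm t\<close> against \<open>a\<close> reaches
  exactly the instance of \<open>t\<close> at \<open>a\<close>, realizers can be checked like typed
  lambda terms.\<close>

lemma forces_lm:
  assumes "over (QP A) t" "env s" "\<And>a. forces E A a F \<Longrightarrow> forces E A (ev (a \<lhd> s) t) G"
  shows "forces E A (ev s (lm t)) (F \<^bold>\<rightarrow> G)"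
proof (rule forces_ImpI)
  show "ev s (lm t) \<in>\<^sub>M Terms A"
    using assms by (simp add: ev_Terms)
next
  fix a \<pi> assume "forces E A a F" "\<pi> \<in> falsity E A G"
  then show "star E A (ev s (lm t)) (push E A a \<pi>) \<in>\<^sub>M Pole A"
    using assms by (intro Pole_lm) (auto intro: forces_Terms falsity_Stacks forces_Pole)
qed

lemma forces_app:
  assumes "forces E A \<xi> (F \<^bold>\<rightarrow> G)" "forces E A \<eta> F"
  shows "forces E A (app E A \<xi> \<eta>) G"
proof -
  have "star E A (app E A \<xi> \<eta>) \<pi> \<in>\<^sub>M Pole A" if "\<pi> \<in> falsity E A G" for \<pi>
    by (rule Pole_app[OF forces_Terms[OF assms(1)] forces_Terms[OF assms(2)] falsity_Stacks[OF that]
          forces_Pole[OF assms(1) push_falsity[OF assms(2) that]]])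
  then show ?thesis
    using forces_Terms[OF assms(1)] forces_Terms[OF assms(2)] by (simp add: forces_def)
qed

lemma forces_Forall: "forces E A \<xi> (\<^bold>\<forall>x. F x) \<longleftrightarrow> (\<forall>x. forces E A \<xi> (F x))"
  unfolding forces_def by auto

text \<open>A stack in the falsity value of the universal formula already belongs to one instance,
  and \<xi> is the same for all instances.\<close>

lemma forces_Imp_Forall:
  assumes "\<And>x. forces E A \<xi> (F \<^bold>\<rightarrow> G x)"
  shows "forces E A \<xi> (F \<^bold>\<rightarrow> (\<^bold>\<forall>x. G x))"
proof (rule forces_ImpI)
  fix a \<pi> assume a: "forces E A a F" and "\<pi> \<in> falsity E A (\<^bold>\<forall>x. G x)"
  then obtain x where "\<pi> \<in> falsity E A (G x)"
    by auto
  from forces_Pole[OF assms push_falsity[OF a this]]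
  show "star E A \<xi> (push E A a \<pi>) \<in>\<^sub>M Pole A" .
qed (rule forces_Terms[OF assms])

section \<open>Absurdity, continuations and classical reasoning\<close>

lemma forces_Bottom: "forces E A \<xi> Bottom \<Longrightarrow> forces E A \<xi> F"
  unfolding forces_def using falsity_Stacks by auto

text \<open>A continuation replaces the current stack by \<pi>, against which every realizer of
  \<open>F\<close> lands in the pole; hence \<open>G\<close> is arbitrary.\<close>

lemma forces_cont:
  assumes "\<pi> \<in> falsity E A F"
  shows "forces E A (cont E A \<pi>) (F \<^bold>\<rightarrow> G)"
  using falsity_Stacks[OF assms]
  by (auto intro!: forces_ImpI Pole_cont intro: forces_Terms falsity_Stacks forces_Pole assms)

lemma forces_cc:
  assumes "forces E A \<xi> ((F \<^bold>\<rightarrow> G) \<^bold>\<rightarrow> F)"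
  shows "forces E A (app E A (ccc A) \<xi>) F"
proof -
  have "star E A (app E A (ccc A) \<xi>) \<pi> \<in>\<^sub>M Pole A" if "\<pi> \<in> falsity E A F" for \<pi>
    using forces_Pole[OF assms push_falsity[OF forces_cont[OF that] that]]
      forces_Terms[OF assms] falsity_Stacks[OF that] by (intro Pole_app Pole_cc) simp_all
  then show ?thesis
    using forces_Terms[OF assms] by (simp add: forces_def)
qed

text \<open>Proof by contradiction: the body, which derives absurdity from the negation of
  \<open>F\<close>, also realizes \<open>F\<close>, so Peirce's law applies.\<close>

lemma forces_cc_lm:
  assumes "over (QP A) t" "env s"
    and "\<And>k. forces E A k (F \<^bold>\<rightarrow> Bottom) \<Longrightarrow> forces E A (ev (k \<lhd> s) t) Bottom"
  shows "forces E A (app E A (ccc A) (ev s (lm t))) F"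
  using assms by (blast intro: forces_cc forces_lm forces_Bottom)

abbreviation closed :: "'v poly \<Rightarrow> 'v" where
  "closed t \<equiv> ev (\<lambda>_. cI A) t"

lemma env_I [simp]: "env (\<lambda>_. cI A)"
  by (simp add: env_def)

lemma closed_QP: "over (QP A) t \<Longrightarrow> closed t \<in>\<^sub>M QP A"
  by (simp add: ev_QP)

section \<open>Realizers for conjunction and existential quantification\<close>

definition pair :: 'v where
  "pair = closed (lm (lm (lm (Ap (Ap (Var 0) (Var 2)) (Var 1)))))"

text \<open>With named variables:
  \<open>\<lambda>v f. cc (\<lambda>k. v (\<lambda>x y. k (f x y)))\<close>.\<close>

definition split :: 'v where
  "split = closed (lm (lm (Ap (Cst (ccc A)) (lm (Ap (Var 2)
     (lm (lm (Ap (Var 2) (Ap (Ap (Var 3) (Var 1)) (Var 0))))))))))"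

definition witness :: 'v where
  "witness = closed (lm (lm (Ap (Var 0) (Var 1))))"

text \<open>With named variables:
  \<open>\<lambda>v f. cc (\<lambda>k. v (\<lambda>x. k (f x)))\<close>.\<close>

definition unpack :: 'v where
  "unpack = closed (lm (lm (Ap (Cst (ccc A)) (lm (Ap (Var 2)
     (lm (Ap (Var 1) (Ap (Var 2) (Var 0)))))))))"

lemma logic_QP [simp]:
  "pair \<in>\<^sub>M QP A" "split \<in>\<^sub>M QP A" "witness \<in>\<^sub>M QP A" "unpack \<in>\<^sub>M QP A"
  unfolding pair_def split_def witness_def unpack_def by (rule closed_QP, simp)+

lemma forces_Conj:
  assumes "forces E A \<xi> F" "forces E A \<eta> G"
  shows "forces E A (app E A (app E A pair \<xi>) \<eta>) (F \<^bold>\<and> G)"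
proof -
  have "forces E A pair (F \<^bold>\<rightarrow> G \<^bold>\<rightarrow> (F \<^bold>\<rightarrow> G \<^bold>\<rightarrow> Bottom) \<^bold>\<rightarrow> Bottom)"
    unfolding pair_def
    by (intro forces_lm) (auto intro: forces_Terms forces_app)
  from forces_app[OF forces_app[OF this assms(1)] assms(2)] show ?thesis
    unfolding Conj_def Negation_def .
qed

lemma forces_Iff:
  assumes "forces E A \<xi> (F \<^bold>\<rightarrow> G)" "forces E A \<eta> (G \<^bold>\<rightarrow> F)"
  shows "forces E A (app E A (app E A pair \<xi>) \<eta>) (F \<^bold>\<leftrightarrow> G)"
  unfolding Iff_def by (rule forces_Conj[OF assms])

text \<open>The encoded conjunction by itself only yields \<open>Bottom\<close>. Capturing a
  continuation \<open>k\<close> for \<open>H\<close> with \<open>cc\<close> makes it usable for an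
  arbitrary conclusion.\<close>

lemma forces_Conj_elim:
  assumes "forces E A \<xi> (F \<^bold>\<and> G)" "forces E A \<eta> (F \<^bold>\<rightarrow> G \<^bold>\<rightarrow> H)"
  shows "forces E A (app E A (app E A split \<xi>) \<eta>) H"
proof -
  have "forces E A split (((F \<^bold>\<rightarrow> G \<^bold>\<rightarrow> Bottom) \<^bold>\<rightarrow> Bottom) \<^bold>\<rightarrow> (F \<^bold>\<rightarrow> G \<^bold>\<rightarrow> H) \<^bold>\<rightarrow> H)"
    unfolding split_def
  proof (intro forces_lm)
    fix v f assume v: "forces E A v ((F \<^bold>\<rightarrow> G \<^bold>\<rightarrow> Bottom) \<^bold>\<rightarrow> Bottom)"
      and f: "forces E A f (F \<^bold>\<rightarrow> G \<^bold>\<rightarrow> H)"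
    let ?s = "f \<lhd> v \<lhd> (\<lambda>_. cI A)" and ?t = "lm (lm (Ap (Var 2) (Ap (Ap (Var 3) (Var 1)) (Var 0))))"
    have env: "env ?s"
      using v f by (auto intro: forces_Terms)
    have "forces E A (app E A v (ev (k \<lhd> ?s) ?t)) Bottom" if "forces E A k (H \<^bold>\<rightarrow> Bottom)" for k
      by (intro forces_app[OF v] forces_lm) (use that env f in \<open>auto intro: forces_Terms forces_app\<close>)
    then show "forces E A (ev ?s (Ap (Cst (ccc A)) (lm (Ap (Var 2) ?t)))) H"
      unfolding ev.simps using env by (intro forces_cc_lm) simp_all
  qed (auto intro: forces_Terms)
  from forces_app[OF forces_app[OF this assms(1)[unfolded Conj_def Negation_def]] assms(2)]
  show ?thesis .
qed

lemma forces_Exists: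
  assumes "forces E A \<xi> (F a)"
  shows "forces E A (app E A witness \<xi>) (\<^bold>\<exists>x. F x)"
proof -
  have "forces E A witness (F a \<^bold>\<rightarrow> (\<^bold>\<forall>x. F x \<^bold>\<rightarrow> Bottom) \<^bold>\<rightarrow> Bottom)"
    unfolding witness_def
    by (intro forces_lm) (auto intro: forces_Terms forces_app simp: forces_Forall)
  from forces_app[OF this assms] show ?thesis
    unfolding Exists_def Negation_def .
qed

text \<open>As for conjunction, \<open>cc\<close> supplies the arbitrary conclusion. The term \<eta>
  must serve all \<open>x\<close> at once, because realizers do not see individuals.\<close>

lemma forces_Exists_elim:
  assumes "forces E A \<xi> (\<^bold>\<exists>x. F x)" "\<And>x. forces E A \<eta> (F x \<^bold>\<rightarrow> H)"
  shows "forces E A (app E A (app E A unpack \<xi>) \<eta>) H"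
proof -
  have "forces E A unpack
      (((\<^bold>\<forall>x. F x \<^bold>\<rightarrow> Bottom) \<^bold>\<rightarrow> Bottom) \<^bold>\<rightarrow> (\<^bold>\<forall>x. F x \<^bold>\<rightarrow> H) \<^bold>\<rightarrow> H)"
    unfolding unpack_def
  proof (intro forces_lm)
    fix v f assume v: "forces E A v ((\<^bold>\<forall>x. F x \<^bold>\<rightarrow> Bottom) \<^bold>\<rightarrow> Bottom)"
      and f: "forces E A f (\<^bold>\<forall>x. F x \<^bold>\<rightarrow> H)"
    let ?s = "f \<lhd> v \<lhd> (\<lambda>_. cI A)" and ?t = "lm (Ap (Var 1) (Ap (Var 2) (Var 0)))"
    have env: "env ?s"
      using v f by (auto intro: forces_Terms)
    have "forces E A (ev (k \<lhd> ?s) ?t) (F x \<^bold>\<rightarrow> Bottom)"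
      if "forces E A k (H \<^bold>\<rightarrow> Bottom)" for k x
      by (intro forces_lm)
        (use that env f in \<open>auto simp: forces_Forall intro: forces_Terms forces_app\<close>)
    then have "forces E A (app E A v (ev (k \<lhd> ?s) ?t)) Bottom"
      if "forces E A k (H \<^bold>\<rightarrow> Bottom)" for k
      by (intro forces_app[OF v]) (simp add: that forces_Forall)
    then show "forces E A (ev ?s (Ap (Cst (ccc A)) (lm (Ap (Var 2) ?t)))) H"
      unfolding ev.simps using env by (intro forces_cc_lm) simp_all
  qed (auto intro: forces_Terms)
  from forces_app[OF this assms(1)[unfolded Exists_def Negation_def]] assms(2)
  show ?thesis
    by (auto simp: forces_Forall intro: forces_app)
qed

text \<open>The falsity value depends only on whether \<open>a\<close> and \<open>b\<close> are the
  same individual of the ground model; for distinct ones it is that of \<open>Top\<close> implies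
  \<open>Bottom\<close>.\<close>

lemma falsity_Equal:
  "falsity E A (a \<^bold>= b) = {push E A \<xi> \<pi> | \<xi> \<pi>. \<xi> \<in>\<^sub>M Terms A \<and> \<pi> \<in>\<^sub>M Stacks A \<and>
     (a = b \<longrightarrow> star E A \<xi> \<pi> \<in>\<^sub>M Pole A)}" (is "_ = ?R")
proof
  show "falsity E A (a \<^bold>= b) \<subseteq> ?R"
  proof
    fix \<rho> assume "\<rho> \<in> falsity E A (a \<^bold>= b)"
    then obtain z \<xi> \<pi> where "\<rho> = push E A \<xi> \<pi>" "forces E A \<xi> (NotEps a z)"
      "\<pi> \<in> falsity E A (NotEps b z)"
      unfolding Equal_def falsity.simps(7) falsity_Imp by blast
    then show "\<rho> \<in> ?R"
      by (blast intro: forces_Terms forces_Pole falsity_Stacks)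
  qed
  show "?R \<subseteq> falsity E A (a \<^bold>= b)"
  proof
    fix \<rho> assume "\<rho> \<in> ?R"
    then obtain \<xi> \<pi> where \<rho>: "\<rho> = push E A \<xi> \<pi>" "\<xi> \<in>\<^sub>M Terms A" "\<pi> \<in>\<^sub>M Stacks A"
      "a = b \<longrightarrow> star E A \<xi> \<pi> \<in>\<^sub>M Pole A"
      by blast
    \<comment> \<open>With \<open>z\<close> the singleton of \<open>(b, \<pi>)\<close>, the falsity
      value of \<open>NotEps b z\<close> is just \<pi>, and that of \<open>NotEps a z\<close> is
      empty if \<open>a\<close> differs from \<open>b\<close>.\<close>
    let ?z = "upair E (opair E b \<pi>) (opair E b \<pi>)"
    have "forces E A \<xi> (NotEps a ?z)" "\<pi> \<in> falsity E A (NotEps b ?z)"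
      using \<rho> by (auto simp: forces_def)
    then have "\<rho> \<in> falsity E A (NotEps a ?z \<^bold>\<rightarrow> NotEps b ?z)"
      unfolding \<rho>(1) by (rule push_falsity)
    then show "\<rho> \<in> falsity E A (a \<^bold>= b)"
      unfolding Equal_def by auto
  qed
qed

text \<open>If the relation fails, \<xi> realizes 0 = 1, and then any term may be pushed in front of
  any stack. So \<eta> has to realize \<open>F\<close> only when the relation holds in the ground
  model.\<close>

lemma forces_char_fun_elim:
  assumes "forces E A \<xi> (char_fun E r x u \<^bold>= one E)" "\<eta> \<in>\<^sub>M Terms A"
    and "opair E x u \<in>\<^sub>M r \<Longrightarrow> forces E A \<eta> F"
  shows "forces E A (app E A \<xi> \<eta>) F"
proof -
  have "star E A \<xi> (push E A \<eta> \<pi>) \<in>\<^sub>M Pole A" if "\<pi> \<in> falsity E A F" for \<pi>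
    by (rule forces_Pole[OF assms(1)])
      (use assms(2,3) that emp_neq_one in
        \<open>auto simp: falsity_Equal char_fun_def intro: falsity_Stacks forces_Pole\<close>)
  then show ?thesis
    using forces_Terms[OF assms(1)] assms(2) unfolding forces_def
    by (auto intro: Pole_app falsity_Stacks)
qed

text \<open>For \<open>a\<close> in \<open>X\<close>, all stacks refute
  \<open>NotEps a (gimel E A X)\<close>, which thus has the falsity value of
  \<open>Bottom\<close>.\<close>

lemma forces_Eps_gimel: "a \<in>\<^sub>M X \<Longrightarrow> forces E A (cI A) (a \<^bold>\<epsilon> gimel E A X)"
  unfolding Eps_def Negation_def gimel_def
  by (rule forces_ImpI) (auto intro!: Pole_I intro: forces_Terms forces_Pole)

section \<open>Transport of an enumeration along an injection\<close>

text \<open>Seen from the realizability model, \<open>h'\<close> is the set of pairs \<open>(n, x)\<close> with \<open>x \<epsilon> X\<close> and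
  \<open>(n, g x) \<epsilon> h\<close>: the continuation \<open>k\<^sub>\<rho>\<close>, for \<open>\<rho> \<in> \<parallel>x \<notin> X\<parallel>\<close>, plays the part of a
  realizer of \<open>x \<epsilon> X\<close>.\<close>

definition transport :: "('v \<Rightarrow> bool) \<Rightarrow> ('v \<Rightarrow> 'v) \<Rightarrow> 'v \<Rightarrow> 'v \<Rightarrow> 'v \<Rightarrow> bool" where
  "transport S g X h h' \<longleftrightarrow> (\<forall>n x. falsity E A (NotEps (opair E n x) h') =
     {push E A (cont E A \<rho>) \<pi> | \<rho> \<pi>. S x \<and> \<rho> \<in> falsity E A (NotEps x X) \<and>
        \<pi> \<in> falsity E A (NotEps (opair E n (g x)) h)})"

lemma transport_exists:
  assumes g: "is_fun E g a b"
  shows "\<exists>h'. transport (\<lambda>x. x \<in>\<^sub>M a) (ap E g) X h h'"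
proof -
  \<comment> \<open>Here \<open>c\<close> and \<open>p\<close> are the graphs of the continuation
    and push operations, so that \<open>k\<close> is the continuation of \<rho> and \<sigma> is
    \<open>k\<close> pushed on \<pi>. The letters \<open>w\<close>, \<open>v\<close> and
    \<open>m\<close> name nested pairs, as the definability rules accept only pairs of
    variables.\<close>
  let ?body = "\<lambda>z X g h c p n x y \<rho> k \<pi> w \<sigma> v m. z = opair E w \<sigma> \<and> w = opair E n x \<and>
    v = opair E n y \<and> m = opair E k \<pi> \<and> opair E x \<rho> \<in>\<^sub>M X \<and> opair E x y \<in>\<^sub>M g \<and>
    opair E v \<pi> \<in>\<^sub>M h \<and> opair E \<rho> k \<in>\<^sub>M c \<and> opair E m \<sigma> \<in>\<^sub>M p"
  have "definable E (\<lambda>s. ?body (s 0) (s 1) (s 2) (s 3) (s 4) (s 5) (s 6) (s 7) (s 8) (s 9)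
      (s 10) (s 11) (s 12) (s 13) (s 14) (s 15))"
    by (intro definable_conj definable_eq_opair definable_opair_mem)
  from definable_ex[OF definable_ex[OF definable_ex[OF definable_ex[OF definable_ex[OF
    definable_ex[OF definable_ex[OF definable_ex[OF definable_ex[OF definable_ex[OF this,
    of 15], of 14], of 13], of 12], of 11], of 10], of 9], of 8], of 7], of 6]
  have D: "definable E (\<lambda>s. \<exists>n x y \<rho> k \<pi> w \<sigma> v m.
      ?body (s 0) (s 1) (s 2) (s 3) (s 4) (s 5) n x y \<rho> k \<pi> w \<sigma> v m)"
    by simp
  \<comment> \<open>No set bounding \<open>n\<close> is given, so one is extracted from
    \<open>h\<close>: \<open>F\<close> contains the pairs \<open>(n, y)\<close> occurring in
    \<open>h\<close>, and \<open>N\<close> their first components.\<close>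
  obtain F where F: "\<And>x y. opair E x y \<in>\<^sub>M h \<Longrightarrow> x \<in>\<^sub>M F"
    using field_exists by metis
  obtain N where N: "\<And>x y. opair E x y \<in>\<^sub>M F \<Longrightarrow> x \<in>\<^sub>M N"
    using field_exists by metis
  let ?bound = "prod_in E (prod_in E N a) (Stacks A)"
  \<comment> \<open>The default value of the assignment puts \<open>X\<close> into variable
    1.\<close>
  from separation[OF D, of ?bound
      "(\<lambda>_. X)(2 := g, 3 := h, 4 := cont_op A, 5 := push_op A)"]
  obtain h' where h': "\<And>z. z \<in>\<^sub>M h' \<longleftrightarrow> z \<in>\<^sub>M ?bound \<and> (\<exists>n x y \<rho> k \<pi> w \<sigma> v m.
      ?body z X g h (cont_op A) (push_op A) n x y \<rho> k \<pi> w \<sigma> v m)"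
    by auto
  have mem_h': "opair E (opair E n x) \<sigma> \<in>\<^sub>M h' \<longleftrightarrow> (\<exists>\<rho> \<pi>. \<sigma> = push E A (cont E A \<rho>) \<pi> \<and>
      x \<in>\<^sub>M a \<and> \<rho> \<in> falsity E A (NotEps x X) \<and>
      \<pi> \<in> falsity E A (NotEps (opair E n (ap E g x)) h))" for n x \<sigma>
  proof
    assume "opair E (opair E n x) \<sigma> \<in>\<^sub>M h'"
    then obtain y \<rho> k \<pi> where *: "opair E x \<rho> \<in>\<^sub>M X" "opair E x y \<in>\<^sub>M g"
      "opair E (opair E n y) \<pi> \<in>\<^sub>M h" "opair E \<rho> k \<in>\<^sub>M cont_op A"
      "opair E (opair E k \<pi>) \<sigma> \<in>\<^sub>M push_op A"
      unfolding h' by auto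
    have x: "x \<in>\<^sub>M a" "y = ap E g x"
      using is_fun_opairD[OF g *(2)] opair_mem_iff_ap[OF g] *(2) by auto
    have \<rho>: "\<rho> \<in>\<^sub>M Stacks A" "k = cont E A \<rho>"
      using is_fun_opairD[OF cont_op_fun *(4)] opair_mem_iff_ap[OF cont_op_fun] *(4)
      by (auto simp: cont_def)
    have \<pi>: "\<pi> \<in>\<^sub>M Stacks A" "\<sigma> = push E A k \<pi>"
      using is_fun_opairD[OF push_op_fun *(5)] opair_mem_iff_ap[OF push_op_fun] *(5)
      by (auto simp: push_def)
    show "\<exists>\<rho> \<pi>. \<sigma> = push E A (cont E A \<rho>) \<pi> \<and> x \<in>\<^sub>M a \<and> \<rho> \<in> falsity E A (NotEps x X) \<and>
        \<pi> \<in> falsity E A (NotEps (opair E n (ap E g x)) h)"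
      using * x \<rho> \<pi> by auto
  next
    assume "\<exists>\<rho> \<pi>. \<sigma> = push E A (cont E A \<rho>) \<pi> \<and> x \<in>\<^sub>M a \<and> \<rho> \<in> falsity E A (NotEps x X) \<and>
        \<pi> \<in> falsity E A (NotEps (opair E n (ap E g x)) h)"
    then obtain \<rho> \<pi> where *: "\<sigma> = push E A (cont E A \<rho>) \<pi>" "x \<in>\<^sub>M a" "\<rho> \<in>\<^sub>M Stacks A"
      "opair E x \<rho> \<in>\<^sub>M X" "\<pi> \<in>\<^sub>M Stacks A" "opair E (opair E n (ap E g x)) \<pi> \<in>\<^sub>M h"
      by auto
    have "opair E x (ap E g x) \<in>\<^sub>M g" "opair E \<rho> (cont E A \<rho>) \<in>\<^sub>M cont_op A"
      "opair E (opair E (cont E A \<rho>) \<pi>) \<sigma> \<in>\<^sub>M push_op A"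
      using * by (simp_all add: opair_mem_iff_ap[OF g] opair_mem_iff_ap[OF cont_op_fun]
          opair_mem_iff_ap[OF push_op_fun] cont_def[symmetric] push_def)
    moreover have "n \<in>\<^sub>M N"
      using N[OF F[OF *(6)]] .
    ultimately show "opair E (opair E n x) \<sigma> \<in>\<^sub>M h'"
      unfolding h' using * by auto
  qed
  have "transport (\<lambda>x. x \<in>\<^sub>M a) (ap E g) X h h'"
    unfolding transport_def by (auto simp: mem_h')
  then show ?thesis ..
qed

section \<open>Realizers acting on the transported enumeration\<close>

definition pull :: 'v where
  "pull = closed (lm (lm (Ap (Var 1) (Ap (Cst (cK A)) (Var 0)))))"

text \<open>With named variables: \<open>\<lambda>w c t. w (cc (\<lambda>k. c (cc (\<lambda>l. k (t
  l)))))\<close>.\<close>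

definition join :: 'v where
  "join = closed (lm (lm (lm (Ap (Var 2) (Ap (Cst (ccc A))
     (lm (Ap (Var 2) (Ap (Cst (ccc A)) (lm (Ap (Var 1) (Ap (Var 2) (Var 0))))))))))))"

definition export :: 'v where
  "export = closed (lm (lm (Ap (Var 1) (lm (Ap (Var 0) (Var 1))))))"

lemma transport_QP [simp]: "pull \<in>\<^sub>M QP A" "join \<in>\<^sub>M QP A" "export \<in>\<^sub>M QP A"
  unfolding pull_def join_def export_def by (rule closed_QP, simp)+

lemma forces_NotEps_transport:
  assumes "transport S g X h h'" "\<xi> \<in>\<^sub>M Terms A"
    and "\<And>\<rho> \<pi>. S x \<Longrightarrow> \<rho> \<in> falsity E A (NotEps x X) \<Longrightarrow>
      \<pi> \<in> falsity E A (NotEps (opair E n (g x)) h) \<Longrightarrow>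
      star E A \<xi> (push E A (cont E A \<rho>) \<pi>) \<in>\<^sub>M Pole A"
  shows "forces E A \<xi> (NotEps (opair E n x) h')"
  using assms unfolding transport_def forces_def by auto

text \<open>\<open>K\<close> discards the continuation on top of a stack refuting
  \<open>(n, x)\<close> in \<open>h'\<close> and leaves a stack refuting \<open>(n, g x)\<close> in
  \<open>h\<close>. Outside \<open>S\<close> there are no such stacks, so \<open>z\<close> is
  unconstrained there.\<close>

lemma forces_pull:
  assumes "transport S g X h h'" "forces E A \<xi> (opair E n x \<^bold>\<epsilon> h')" "S x \<Longrightarrow> z = g x"
  shows "forces E A (app E A pull \<xi>) (opair E n z \<^bold>\<epsilon> h)"
proof -
  have "forces E A (app E A (cK A) k) (NotEps (opair E n x) h')"
    if "forces E A k (NotEps (opair E n z) h)" for k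
    using forces_Terms[OF that] forces_Pole[OF that] assms(3) falsity_Stacks
    by (intro forces_NotEps_transport[OF assms(1)]) (simp_all, intro Pole_app Pole_K, simp_all)
  then have "forces E A pull ((NotEps (opair E n x) h' \<^bold>\<rightarrow> Bottom) \<^bold>\<rightarrow> NotEps (opair E n z) h \<^bold>\<rightarrow> Bottom)"
    unfolding pull_def by (intro forces_lm) (auto intro: forces_Terms forces_app)
  from forces_app[OF this assms(2)[unfolded Eps_def Negation_def]] show ?thesis
    unfolding Eps_def Negation_def .
qed

text \<open>Unlike \<open>forces_cc_lm\<close>, this retains that the captured term is the
  continuation of the very stack in use. \<open>forces_join\<close> relies on it, as the stacks for
  \<open>h'\<close> begin with genuine continuations.\<close>

lemma forces_cc_star:
  assumes "over (QP A) t" "env s"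
    and "\<And>\<pi>. \<pi> \<in> falsity E A F \<Longrightarrow> star E A (ev (cont E A \<pi> \<lhd> s) t) \<pi> \<in>\<^sub>M Pole A"
  shows "forces E A (app E A (ccc A) (ev s (lm t))) F"
  unfolding forces_def using assms
  by (auto simp: ev_Terms intro!: Pole_app Pole_cc Pole_lm dest: falsity_Stacks)

text \<open>Two uses of \<open>cc\<close> capture a stack \<pi> against \<open>(n, g x)\<close> in
  \<open>h\<close> and a stack \<rho> against \<open>x\<close> in \<open>X\<close>. The inner body
  then restores \<pi> and runs \<open>t\<close> against the continuation of \<rho> followed by
  \<pi>, a stack for \<open>h'\<close>.\<close>

lemma forces_join:
  assumes "transport S g X h h'" "S x"
    and "forces E A \<xi> (opair E n (g x) \<^bold>\<epsilon> h)" "forces E A \<eta> (x \<^bold>\<epsilon> X)"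
  shows "forces E A (app E A (app E A join \<xi>) \<eta>) (opair E n x \<^bold>\<epsilon> h')"
proof -
  let ?H = "NotEps (opair E n (g x)) h" and ?X = "NotEps x X" and ?H' = "NotEps (opair E n x) h'"
  let ?t = "lm (Ap (Var 1) (Ap (Var 2) (Var 0)))"
  have "forces E A join ((?H \<^bold>\<rightarrow> Bottom) \<^bold>\<rightarrow> (?X \<^bold>\<rightarrow> Bottom) \<^bold>\<rightarrow> ?H' \<^bold>\<rightarrow> Bottom)"
    unfolding join_def
  proof (intro forces_lm)
    fix w c t
    assume w: "forces E A w (?H \<^bold>\<rightarrow> Bottom)" and c: "forces E A c (?X \<^bold>\<rightarrow> Bottom)"
      and t: "forces E A t ?H'"
    let ?s = "t \<lhd> c \<lhd> w \<lhd> (\<lambda>_. cI A)"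
    have [simp]: "w \<in>\<^sub>M Terms A" "c \<in>\<^sub>M Terms A" "t \<in>\<^sub>M Terms A"
      using w c t by (auto intro: forces_Terms)
    have "forces E A (app E A (ccc A) (ev (cont E A \<pi> \<lhd> ?s) ?t)) ?X"
      if \<pi>: "\<pi> \<in> falsity E A ?H" for \<pi>
    proof (rule forces_cc_star)
      fix \<rho> assume \<rho>: "\<rho> \<in> falsity E A ?X"
      have "push E A (cont E A \<rho>) \<pi> \<in> falsity E A ?H'"
        using assms(1,2) \<pi> \<rho> unfolding transport_def by blast
      from forces_Pole[OF t this]
      show "star E A (ev (cont E A \<rho> \<lhd> cont E A \<pi> \<lhd> ?s)
          (Ap (Var 1) (Ap (Var 2) (Var 0)))) \<rho> \<in>\<^sub>M Pole A"
        using falsity_Stacks[OF \<pi>] falsity_Stacks[OF \<rho>]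
        by (simp, intro Pole_app Pole_cont) simp_all
    qed (use falsity_Stacks[OF \<pi>] in simp_all)
    note star_c = forces_app[OF c this, THEN forces_Pole]
    have "forces E A (app E A (ccc A)
        (ev ?s (lm (Ap (Var 2) (Ap (Cst (ccc A)) ?t))))) ?H"
      by (rule forces_cc_star) (use star_c falsity_Stacks in \<open>simp_all del: falsity.simps(3)\<close>)
    from forces_app[OF w this]
    show "forces E A (ev ?s (Ap (Var 2) (Ap (Cst (ccc A))
        (lm (Ap (Var 2) (Ap (Cst (ccc A)) ?t)))))) Bottom"
      by simp
  qed (auto intro: forces_Terms)
  from forces_app[OF forces_app[OF this assms(3)[unfolded Eps_def Negation_def]]
      assms(4)[unfolded Eps_def Negation_def]]
  show ?thesis
    unfolding Eps_def Negation_def .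
qed

text \<open>The continuation found on a stack for \<open>h'\<close> is applied to \<open>k\<close>;
  this restores \<rho>, which refutes \<open>x\<close> in \<open>X\<close>, and runs
  \<open>k\<close> against it.\<close>

lemma forces_export:
  assumes "transport S g X h h'" "forces E A \<xi> (opair E n x \<^bold>\<epsilon> h')"
  shows "forces E A (app E A export \<xi>) (x \<^bold>\<epsilon> X)"
proof -
  let ?X = "NotEps x X" and ?H' = "NotEps (opair E n x) h'"
  have "forces E A export ((?H' \<^bold>\<rightarrow> Bottom) \<^bold>\<rightarrow> ?X \<^bold>\<rightarrow> Bottom)"
    unfolding export_def
  proof (intro forces_lm)
    fix m k
    assume m: "forces E A m (?H' \<^bold>\<rightarrow> Bottom)" and k: "forces E A k ?X"
    let ?s = "k \<lhd> m \<lhd> (\<lambda>_. cI A)"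
    have [simp]: "m \<in>\<^sub>M Terms A" "k \<in>\<^sub>M Terms A"
      using m k by (auto intro: forces_Terms)
    have "forces E A (ev ?s (lm (Ap (Var 0) (Var 1)))) ?H'"
    proof (rule forces_NotEps_transport[OF assms(1)])
      fix \<rho> \<pi>
      assume "\<rho> \<in> falsity E A ?X" "\<pi> \<in> falsity E A (NotEps (opair E n (g x)) h)"
      then show "star E A (ev ?s (lm (Ap (Var 0) (Var 1)))) (push E A (cont E A \<rho>) \<pi>) \<in>\<^sub>M Pole A"
        using falsity_Stacks forces_Pole[OF k]
        by (intro Pole_lm) (simp_all, intro Pole_app Pole_cont, simp_all)
    qed (simp add: ev_Terms)
    from forces_app[OF m this]
    show "forces E A (ev ?s (Ap (Var 1) (lm (Ap (Var 0) (Var 1))))) Bottom"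
      by simp
  qed (auto intro: forces_Terms)
  from forces_app[OF this assms(2)[unfolded Eps_def Negation_def]] show ?thesis
    unfolding Eps_def Negation_def .
qed

section \<open>Countability of bounded subsets\<close>

definition functional :: 'v where
  "functional = closed (lm (lm (lm (Ap (Ap (Var 2) (Ap (Cst pull) (Var 1))) (Ap (Cst pull) (Var 0))))))"

text \<open>With named variables: \<open>\<lambda>q c. split q (\<lambda>q1 q2. unpack (q1 I)
  (\<lambda>w. split w (\<lambda>i e. witness (pair i (join e c)))))\<close>.\<close>

definition locate :: 'v where
  "locate = closed (lm (lm (Ap (Ap (Cst split) (Var 1)) (lm (lm
     (Ap (Ap (Cst unpack) (Ap (Var 1) (Cst (cI A)))) (lm (Ap (Ap (Cst split) (Var 0)) (lm (lm
       (Ap (Cst witness) (Ap (Ap (Cst pair) (Var 1)) (Ap (Ap (Cst join) (Var 0)) (Var 5))))))))))))))"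

definition sound :: 'v where
  "sound = closed (lm (Ap (Ap (Cst unpack) (Var 0)) (lm (Ap (Ap (Cst split) (Var 0))
     (lm (lm (Ap (Cst export) (Var 0))))))))"

definition complete :: 'v where
  "complete = closed (lm (lm (lm (Ap (Ap (Var 1) (Var 0)) (Ap (Ap (Cst locate) (Var 2)) (Var 0))))))"

definition count :: 'v where
  "count = closed (lm (lm (lm (Ap (Cst witness) (Ap (Ap (Cst pair) (Ap (Cst functional) (Var 2)))
     (Ap (Ap (Cst pair) (Ap (Ap (Cst complete) (Var 1)) (Var 0))) (Cst sound)))))))"

lemma main_QP [simp]:
  "functional \<in>\<^sub>M QP A" "locate \<in>\<^sub>M QP A" "sound \<in>\<^sub>M QP A" "complete \<in>\<^sub>M QP A" "count \<in>\<^sub>M QP A"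
proof -
  show locate: "locate \<in>\<^sub>M QP A"
    unfolding locate_def by (rule closed_QP, simp)
  show functional: "functional \<in>\<^sub>M QP A"
    unfolding functional_def by (rule closed_QP, simp)
  show sound: "sound \<in>\<^sub>M QP A"
    unfolding sound_def by (rule closed_QP, simp)
  show complete: "complete \<in>\<^sub>M QP A"
    unfolding complete_def by (rule closed_QP, simp add: locate)
  show "count \<in>\<^sub>M QP A"
    unfolding count_def by (rule closed_QP, simp add: functional sound complete)
qed

text \<open>By \<open>pull\<close>, the hypotheses on \<open>h'\<close> become hypotheses on
  \<open>h\<close>, whose functionality equates the images. As equality of the images implies
  \<open>y = y'\<close> in the ground model, the falsity value of \<open>y = y'\<close> is included
  in that of the image equation, and the same term realizes it.\<close>

lemma forces_functional:
  assumes tr: "transport S g X h h'" and inj: "\<And>x y. S x \<Longrightarrow> S y \<Longrightarrow> g x = g y \<Longrightarrow> x = y"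
    and "forces E A \<xi> (Functional E h)"
  shows "forces E A (app E A functional \<xi>) (Functional E h')"
proof -
  have "forces E A functional (Functional E h \<^bold>\<rightarrow>
      (opair E n y \<^bold>\<epsilon> h' \<^bold>\<rightarrow> opair E n y' \<^bold>\<epsilon> h' \<^bold>\<rightarrow> y \<^bold>= y'))" for n y y'
    unfolding functional_def
  proof (intro forces_lm)
    fix p e e'
    assume p: "forces E A p (Functional E h)" and e: "forces E A e (opair E n y \<^bold>\<epsilon> h')"
      and e': "forces E A e' (opair E n y' \<^bold>\<epsilon> h')"
    \<comment> \<open>Outside \<open>S\<close> the realizers \<open>e\<close> and \<open>e'\<close> are absurd, so \<open>z\<close> and \<open>z'\<close> can be chosen
      distinct and \<open>z = z'\<close> has the largest possible falsity value.\<close>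
    obtain z z' where z: "S y \<Longrightarrow> z = g y" "S y' \<Longrightarrow> z' = g y'" "z = z' \<Longrightarrow> y = y'"
    proof (cases "S y \<and> S y'")
      case True
      with inj show thesis
        by (intro that[of "g y" "g y'"]) auto
    next
      case False
      obtain b where "b \<noteq> g y" "b \<noteq> g y' \<or> g y \<noteq> g y'"
        using emp_neq_one by metis
      moreover obtain c where "c \<noteq> g y'"
        using emp_neq_one by metis
      ultimately show thesis
        using False that[of "g y" b] that[of c "g y'"] by metis
    qed
    have "forces E A p (opair E n z \<^bold>\<epsilon> h \<^bold>\<rightarrow> opair E n z' \<^bold>\<epsilon> h \<^bold>\<rightarrow> z \<^bold>= z')"
      using p unfolding Functional_def forces_Forall by blast
    from forces_app[OF forces_app[OF this forces_pull[OF tr e z(1)]] forces_pull[OF tr e' z(2)]]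
    have "forces E A (app E A (app E A p (app E A pull e)) (app E A pull e')) (z \<^bold>= z')" .
    moreover have "falsity E A (y \<^bold>= y') \<subseteq> falsity E A (z \<^bold>= z')"
      using z(3) unfolding falsity_Equal by blast
    ultimately show "forces E A (ev (e' \<lhd> e \<lhd> p \<lhd> (\<lambda>_. cI A))
        (Ap (Ap (Var 2) (Ap (Cst pull) (Var 1))) (Ap (Cst pull) (Var 0)))) (y \<^bold>= y')"
      by (auto simp: forces_def)
  qed (auto intro: forces_Terms)
  from forces_app[OF this assms(3)] show ?thesis
    unfolding Functional_def[of E h'] forces_Forall by blast
qed

text \<open>Since \<open>g x\<close> is in \<open>Y\<close>, the term \<open>I\<close> realizes its
  membership in \<open>gimel E A Y\<close>. The enumeration \<open>h\<close> then yields an integer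
  for \<open>g x\<close>, and \<open>join\<close> makes it one for \<open>x\<close>.\<close>

lemma forces_locate:
  assumes tr: "transport S g X h h'" and x: "S x" "g x \<in>\<^sub>M Y"
    and "forces E A \<xi> (\<^bold>\<forall>x. x \<^bold>\<epsilon> gimel E A Y \<^bold>\<leftrightarrow> (\<^bold>\<exists>n. Integer E n \<^bold>\<and> opair E n x \<^bold>\<epsilon> h))"
    and "forces E A \<eta> (x \<^bold>\<epsilon> X)"
  shows "forces E A (app E A (app E A locate \<xi>) \<eta>) (\<^bold>\<exists>n. Integer E n \<^bold>\<and> opair E n x \<^bold>\<epsilon> h')"
    (is "forces E A _ ?goal")
proof -
  let ?ex = "\<lambda>x h. \<^bold>\<exists>n. Integer E n \<^bold>\<and> opair E n x \<^bold>\<epsilon> h"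
  have "forces E A locate ((g x \<^bold>\<epsilon> gimel E A Y \<^bold>\<leftrightarrow> ?ex (g x) h) \<^bold>\<rightarrow> x \<^bold>\<epsilon> X \<^bold>\<rightarrow> ?goal)"
    unfolding locate_def
  proof (intro forces_lm, goal_cases)
    case (5 q c)
    then have [simp]: "q \<in>\<^sub>M Terms A" "c \<in>\<^sub>M Terms A"
      by (auto intro: forces_Terms)
    show ?case
      unfolding ev.simps nat.case
      apply (rule forces_Conj_elim)
       apply (simp, rule 5(1)[unfolded Iff_def])
    proof (intro forces_lm, goal_cases)
      case (5 q1 q2)
      then have [simp]: "q1 \<in>\<^sub>M Terms A" "q2 \<in>\<^sub>M Terms A"
        by (auto intro: forces_Terms)
      show ?case
        unfolding ev.simps nat.case
        apply (rule forces_Exists_elim)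
         apply (simp, rule forces_app[OF 5(1) forces_Eps_gimel[OF x(2)]])
      proof (intro forces_lm, goal_cases)
        case (3 n w)
        then have [simp]: "w \<in>\<^sub>M Terms A"
          by (auto intro: forces_Terms)
        show ?case
          unfolding ev.simps nat.case
          apply (rule forces_Conj_elim[OF 3])
          apply (intro forces_lm)
          using \<open>forces E A c (x \<^bold>\<epsilon> X)\<close> x(1)
          by (auto intro: forces_Terms intro!: forces_Exists forces_Conj forces_join[OF tr])
      qed simp_all
    qed (auto intro: forces_Terms)
  qed (auto intro: forces_Terms)
  from forces_app[OF forces_app[OF this] assms(5)] assms(4) show ?thesis
    unfolding forces_Forall by blast
qed

lemma forces_sound:
  assumes tr: "transport S g X h h'"
  shows "forces E A sound ((\<^bold>\<exists>n. Integer E n \<^bold>\<and> opair E n x \<^bold>\<epsilon> h') \<^bold>\<rightarrow> x \<^bold>\<epsilon> X)"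
  unfolding sound_def
proof (intro forces_lm, goal_cases)
  case (3 v)
  then have [simp]: "v \<in>\<^sub>M Terms A"
    by (rule forces_Terms)
  show ?case
    unfolding ev.simps nat.case
  proof (rule forces_Exists_elim[OF 3], intro forces_lm, goal_cases)
    case (3 n w)
    then have [simp]: "w \<in>\<^sub>M Terms A"
      by (auto intro: forces_Terms)
    show ?case
      unfolding ev.simps nat.case
      by (rule forces_Conj_elim[OF 3], intro forces_lm)
        (auto intro: forces_Terms intro!: forces_export[OF tr])
  qed simp_all
qed simp_all

text \<open>The bound turns a realizer of membership in \<open>X\<close> into one of the equation
  for \<open>x\<close> and \<open>u\<close>. Applied to the term built with \<open>locate\<close>,
  it needs that term to be correct only if \<open>x\<close> precedes \<open>u\<close>.\<close>

lemma forces_complete: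
  assumes tr: "transport (\<lambda>x. opair E x u \<in>\<^sub>M r) g X h h'"
    and g: "\<And>x. opair E x u \<in>\<^sub>M r \<Longrightarrow> g x \<in>\<^sub>M Y"
    and \<xi>: "forces E A \<xi> (\<^bold>\<forall>x. x \<^bold>\<epsilon> gimel E A Y \<^bold>\<leftrightarrow> (\<^bold>\<exists>n. Integer E n \<^bold>\<and> opair E n x \<^bold>\<epsilon> h))"
      (is "forces E A _ ?Q")
    and \<eta>: "forces E A \<eta> (\<^bold>\<forall>x. x \<^bold>\<epsilon> X \<^bold>\<rightarrow> char_fun E r x u \<^bold>= one E)" (is "forces E A _ ?R")
  shows "forces E A (app E A (app E A complete \<xi>) \<eta>)
    (x \<^bold>\<epsilon> X \<^bold>\<rightarrow> (\<^bold>\<exists>n. Integer E n \<^bold>\<and> opair E n x \<^bold>\<epsilon> h'))" (is "forces E A _ (_ \<^bold>\<rightarrow> ?goal)")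
proof -
  have "forces E A complete (?Q \<^bold>\<rightarrow> ?R \<^bold>\<rightarrow> x \<^bold>\<epsilon> X \<^bold>\<rightarrow> ?goal)"
    unfolding complete_def
  proof (intro forces_lm)
    fix q r' c
    assume q: "forces E A q ?Q" and r': "forces E A r' ?R" and c: "forces E A c (x \<^bold>\<epsilon> X)"
    have "forces E A (app E A r' c) (char_fun E r x u \<^bold>= one E)"
      using r' c unfolding forces_Forall by (blast intro: forces_app)
    moreover have "app E A (app E A locate q) c \<in>\<^sub>M Terms A"
      by (intro app_Terms QP_Terms main_QP forces_Terms[OF q] forces_Terms[OF c])
    ultimately show "forces E A (ev (c \<lhd> r' \<lhd> q \<lhd> (\<lambda>_. cI A))
        (Ap (Ap (Var 1) (Var 0)) (Ap (Ap (Cst locate) (Var 2)) (Var 0)))) ?goal"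
      using forces_locate[OF tr _ g q c] by (auto intro: forces_char_fun_elim)
  qed (auto intro: forces_Terms)
  from forces_app[OF forces_app[OF this \<xi>] \<eta>] show ?thesis .
qed

text \<open>The witness is the relation \<open>h'\<close> transported along \<open>g\<close>.
  Neither occurs in \<open>count\<close>, so one term serves all choices of \<open>u\<close>,
  \<open>h\<close> and \<open>X\<close>.\<close>

lemma forces_count:
  assumes g: "is_fun E g s Y" and s: "\<And>x. x \<in>\<^sub>M s \<longleftrightarrow> opair E x u \<in>\<^sub>M r"
    and inj: "\<And>x y. x \<in>\<^sub>M s \<Longrightarrow> y \<in>\<^sub>M s \<Longrightarrow> ap E g x = ap E g y \<Longrightarrow> x = y"
  shows "forces E A count (Functional E h \<^bold>\<rightarrow>
    (\<^bold>\<forall>x. x \<^bold>\<epsilon> gimel E A Y \<^bold>\<leftrightarrow> (\<^bold>\<exists>n. Integer E n \<^bold>\<and> opair E n x \<^bold>\<epsilon> h)) \<^bold>\<rightarrow>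
    (\<^bold>\<forall>x. x \<^bold>\<epsilon> X \<^bold>\<rightarrow> char_fun E r x u \<^bold>= one E) \<^bold>\<rightarrow> Countable E X)"
proof -
  obtain h' where tr: "transport (\<lambda>x. opair E x u \<in>\<^sub>M r) (ap E g) X h h'"
    using transport_exists[OF g] unfolding s by blast
  have gY: "ap E g x \<in>\<^sub>M Y" if "opair E x u \<in>\<^sub>M r" for x
    using ap_mem[OF g] that unfolding s by blast
  show ?thesis
    unfolding count_def Countable_def
  proof (intro forces_lm, goal_cases)
    case (7 p q b)
    then show ?case
      by (auto simp: forces_Forall intro!: forces_Exists[of _ _ h'] forces_Conj forces_Iff
          forces_functional[OF tr] forces_complete[OF tr gY] forces_sound[OF tr]
          dest: inj[unfolded s])
  qed (auto intro: forces_Terms)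
qed

text \<open>The predecessors of \<open>u\<close> form a proper initial segment for every individual
  \<open>u\<close>, even one outside \<open>Y\<close>, where the segment is empty.\<close>

lemma initial_segment_injection:
  assumes wo: "strict_wellorder E r Y" and Y: "Y \<noteq> emp E"
    and small: "\<And>s. proper_initial_segment E r Y s \<Longrightarrow> lepoll_in E s c"
  obtains g s where "is_fun E g s c" "\<And>x. x \<in>\<^sub>M s \<longleftrightarrow> opair E x u \<in>\<^sub>M r"
    "\<And>x y. x \<in>\<^sub>M s \<Longrightarrow> y \<in>\<^sub>M s \<Longrightarrow> ap E g x = ap E g y \<Longrightarrow> x = y"
proof -
  note wo = wo[unfolded strict_wellorder_def]
  note sub = wo[THEN conjunct1]
    and irrefl = wo[THEN conjunct2, THEN conjunct1]
    and trans = wo[THEN conjunct2, THEN conjunct2, THEN conjunct1]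
  have r: "x \<in>\<^sub>M Y \<and> y \<in>\<^sub>M Y" if "opair E x y \<in>\<^sub>M r" for x y
    using sub that opair_mem_prod_in unfolding subset_in_def by blast
  from separation[OF definable_opair_mem[of 0 1 2], of Y "(\<lambda>_. u)(2 := r)"]
  obtain s where "\<And>x. x \<in>\<^sub>M s \<longleftrightarrow> x \<in>\<^sub>M Y \<and> opair E x u \<in>\<^sub>M r"
    by auto
  then have s: "x \<in>\<^sub>M s \<longleftrightarrow> opair E x u \<in>\<^sub>M r" for x
    using r by blast
  \<comment> \<open>Otherwise any element of \<open>Y\<close> would precede \<open>u\<close>; then
    \<open>u\<close> would be in \<open>Y\<close>, hence in \<open>s\<close>, and would precede
    itself.\<close>
  have "s \<noteq> Y"
  proof
    assume "s = Y"
    obtain y where "y \<in>\<^sub>M Y"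
      using Y extensionality[of Y "emp E"] by auto
    then have "opair E y u \<in>\<^sub>M r"
      unfolding s[symmetric] \<open>s = Y\<close> .
    then have "u \<in>\<^sub>M s"
      using r \<open>s = Y\<close> by simp
    then show False
      unfolding s using irrefl by simp
  qed
  then have "proper_initial_segment E r Y s"
    unfolding proper_initial_segment_def subset_in_def s by (metis r trans)
  from small[OF this] obtain g where g: "is_fun E g s c"
    "\<forall>x y. x \<in>\<^sub>M s \<and> y \<in>\<^sub>M s \<and> ap E g x = ap E g y \<longrightarrow> x = y"
    unfolding lepoll_in_def by (elim exE conjE)
  show thesis
    by (rule that[OF g(1) s]) (simp add: g(2))
qed

section \<open>Assembly of the uniform realizer\<close>

lemma realized_bounded_countable:
  assumes wo: "strict_wellorder E r Y" and Y: "Y \<noteq> emp E"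
    and small: "\<And>s. proper_initial_segment E r Y s \<Longrightarrow> lepoll_in E s c"
  shows "realized E A (Countable E (gimel E A c) \<^bold>\<rightarrow> (\<^bold>\<forall>X. SubEps X (gimel E A Y) \<^bold>\<rightarrow>
    BoundedAbove (\<lambda>x y. char_fun E r x y \<^bold>= one E) (gimel E A Y) X \<^bold>\<rightarrow> Countable E X))"
proof -
  have count: "forces E A count (Functional E h \<^bold>\<rightarrow>
    (\<^bold>\<forall>x. x \<^bold>\<epsilon> gimel E A c \<^bold>\<leftrightarrow> (\<^bold>\<exists>n. Integer E n \<^bold>\<and> opair E n x \<^bold>\<epsilon> h)) \<^bold>\<rightarrow>
    (\<^bold>\<forall>x. x \<^bold>\<epsilon> X \<^bold>\<rightarrow> char_fun E r x u \<^bold>= one E) \<^bold>\<rightarrow> Countable E X)" for h u X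
  proof -
    obtain g s where g: "is_fun E g s c" "\<And>x. x \<in>\<^sub>M s \<longleftrightarrow> opair E x u \<in>\<^sub>M r"
      "\<And>x y. x \<in>\<^sub>M s \<Longrightarrow> y \<in>\<^sub>M s \<Longrightarrow> ap E g x = ap E g y \<Longrightarrow> x = y"
      using initial_segment_injection[OF wo Y small, of u] by metis
    show ?thesis
      by (rule forces_count[OF g])
  qed
  \<comment> \<open>With named variables: \<open>\<lambda>a b d. unpack a (\<lambda>v. split v
    (\<lambda>p q. unpack d (\<lambda>w. split w (\<lambda>e b'. count p q b'))))\<close>. Here
    \<open>a\<close> supplies the enumeration of \<open>gimel E A c\<close> and \<open>d\<close> the
    upper bound.\<close>
  let ?\<theta> = "lm (lm (lm (Ap (Ap (Cst unpack) (Var 2)) (lm (Ap (Ap (Cst split) (Var 0)) (lm (lm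
    (Ap (Ap (Cst unpack) (Var 3)) (lm (Ap (Ap (Cst split) (Var 0)) (lm (lm
      (Ap (Ap (Ap (Cst count) (Var 4)) (Var 3)) (Var 0))))))))))))))"
  have "forces E A (closed ?\<theta>) (Countable E (gimel E A c) \<^bold>\<rightarrow> SubEps X (gimel E A Y) \<^bold>\<rightarrow>
    BoundedAbove (\<lambda>x y. char_fun E r x y \<^bold>= one E) (gimel E A Y) X \<^bold>\<rightarrow> Countable E X)" for X
  proof (intro forces_lm, goal_cases)
    case (7 a b d)
    then have [simp]: "a \<in>\<^sub>M Terms A" "b \<in>\<^sub>M Terms A" "d \<in>\<^sub>M Terms A"
      by (auto intro: forces_Terms)
    show ?case
      unfolding ev.simps
      apply (rule forces_Exists_elim)
       apply (simp, rule 7(1)[unfolded Countable_def])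
    proof (intro forces_lm, goal_cases)
      case (3 h v)
      then have [simp]: "v \<in>\<^sub>M Terms A"
        by (auto intro: forces_Terms)
      show ?case
        unfolding ev.simps
        apply (rule forces_Conj_elim)
         apply (simp, rule 3)
      proof (intro forces_lm, goal_cases)
        case (5 p q)
        then have [simp]: "p \<in>\<^sub>M Terms A" "q \<in>\<^sub>M Terms A"
          by (auto intro: forces_Terms)
        show ?case
          unfolding ev.simps
          apply (rule forces_Exists_elim)
           apply (simp, rule 7(3)[unfolded BoundedAbove_def])
        proof (intro forces_lm, goal_cases)
          case (3 u w)
          then have [simp]: "w \<in>\<^sub>M Terms A"
            by (auto intro: forces_Terms)
          show ?case
            unfolding ev.simps
            apply (rule forces_Conj_elim)
             apply (simp, rule 3)
          proof (intro forces_lm, goal_cases)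
            case (5 e b')
            show ?case
              using forces_app[OF forces_app[OF forces_app[OF count \<open>forces E A p _\<close>]
                    \<open>forces E A q _\<close>] 5(2)] by simp
          qed (auto intro: forces_Terms)
        qed simp_all
      qed (auto intro: forces_Terms)
    qed simp_all
  qed (auto intro: forces_Terms)
  moreover have "closed ?\<theta> \<in>\<^sub>M QP A"
    by (rule closed_QP) simp
  ultimately show ?thesis
    unfolding realized_def by (blast intro: forces_Imp_Forall)
qed

end

theorem theorem31:
  fixes E :: "'v \<Rightarrow> 'v \<Rightarrow> bool" and A :: "'v ralg" and \<kappa> \<kappa>p tri :: 'v
  assumes "ZF E" and "V_eq_L E"
    and "realizability_algebra E A" and "coherent E A"
    and "is_card_of E \<kappa> (un E (un E (Terms A) (Stacks A)) (omega E))"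
    and "\<kappa>p = powerset E \<kappa>"
    and "strict_wellorder E tri \<kappa>p"
    and "least_element E tri \<kappa>p (emp E)"
    and "\<And>s. proper_initial_segment E tri \<kappa>p s \<Longrightarrow> lepoll_in E s \<kappa>"
  shows "realized E A
    (Countable E (gimel E A \<kappa>) \<^bold>\<rightarrow>
      (\<^bold>\<forall>X. SubEps X (gimel E A \<kappa>p) \<^bold>\<rightarrow>
         BoundedAbove (\<lambda>x y. char_fun E tri x y \<^bold>= one E) (gimel E A \<kappa>p) X \<^bold>\<rightarrow>
         Countable E X))"
proof -
  interpret ralgebra E A
    by unfold_locales (use assms in auto)
  have "\<kappa>p \<noteq> emp E"
    using assms(8) unfolding least_element_def by auto
  from realized_bounded_countable[OF assms(7) this assms(9)] show ?thesis .
qed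

end
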